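(* Let $\omega_1,\omega_2\in\mathbf{C}\setminus\{0\}$ with $\Im(\omega_2/\omega_1)>0$, and let $\Lambda=\mathbf{Z}2\omega_1+\mathbf{Z}2\omega_2$. Suppose that $u$ is elliptic of the first kind (with respect to $\Lambda$), and that Hill's equation $-\psi''(x)+u(x)\psi(x)=\lambda\psi(x)$ has a meromorphic fundamental system of solutions for some $\lambda\in\mathbf{C}$. Then Hill's equation has a nontrivial elliptic solution of the second kind, which may be expressed as a quotient of tau functions that arise from uniformly periodic linear systems and linear systems with finite-dimensional state space.
   Context: Uniformly periodic linear system: $A\in\mathcal{L}(H)$ is such that $(e^{xA})_{x\in\mathbf{R}}$ is a periodic group on the Hilbert space $H$, and $B\in\mathcal{L}(H_0,H)$, $C\in\mathcal{L}(H,H_0)$ (with $H_0$ a Hilbert space) satisfy $AE+EA=BC$ for some trace class operator $E$ on $H$; its tau function is $\tau(x)=\det(I+e^{xA}Ee^{xA})$. A linear system with finite-dimensional state space $H$ is given by matrices $(-A,B,C)$ with a solution $R_x$ of $-\frac{dR_x}{dx}=AR_x+R_xA$, $AR_0+R_0A=BC$, and tau function $\tau(x)=\det(I+R_x)$. Elliptic functions for the lattice $\Lambda=\mathbf{Z}2\omega_1+\mathbf{Z}2\omega_2$: a meromorphic function $f$ on $\mathbf{C}$ is elliptic of the first kind if it is doubly periodic with respect to $\Lambda$; it is elliptic of the second kind if there exist multipliers $\rho_j\in\mathbf{C}$ with $f(z+2\omega_j)=\rho_jf(z)$ for $j=1,2$.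
   Formalization: The tau-quotient formula is claimed for x ↦ ψ(cx), for every c ≠ 0 with a nonzero real multiple in Λ (always c = ω₁, ω₂; c = 1 if Λ has a nonzero real element), since tau functions of uniformly periodic systems have real periods and the literal formula fails otherwise. *)

theory Defs
  imports
    "HOL-Complex_Analysis.Complex_Analysis"
    "HOL-Combinatorics.Permutations"
    "Jordan_Normal_Form.Determinant"
begin

section \<open>Complex Hilbert spaces\<close>

text \<open>
  The complex inner product is linear in its first argument; its real part is the
  inner product of the underlying real Hilbert space, so the norm and the topology are the
  ones of \<^class>\<open>real_inner\<close>.
\<close>

class complex_hilbert = real_inner + complete_space +
  fixes scaleC :: "complex \<Rightarrow> 'a \<Rightarrow> 'a"  (infixr \<open>*\<^sub>C\<close> 75)
    and cinner :: "'a \<Rightarrow> 'a \<Rightarrow> complex"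
  assumes scaleC_add_right: "c *\<^sub>C (x + y) = c *\<^sub>C x + c *\<^sub>C y"
    and scaleC_add_left: "(c + d) *\<^sub>C x = c *\<^sub>C x + d *\<^sub>C x"
    and scaleC_scaleC: "c *\<^sub>C d *\<^sub>C x = (c * d) *\<^sub>C x"
    and scaleC_of_real: "complex_of_real r *\<^sub>C x = r *\<^sub>R x"
    and cinner_commute: "cinner x y = cnj (cinner y x)"
    and cinner_add_left: "cinner (x + y) z = cinner x z + cinner y z"
    and cinner_scaleC_left: "cinner (c *\<^sub>C x) y = c * cinner x y"
    and Re_cinner: "Re (cinner x y) = inner x y"

text \<open>The model used for infinite-dimensional state spaces: square-summable sequences.\<close>

typedef ell2 = "{x :: nat \<Rightarrow> complex. summable (\<lambda>n. (cmod (x n))\<^sup>2)}"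
  by (rule exI[of _ "\<lambda>_. 0"]) simp

setup_lifting type_definition_ell2

lemma square_summable_add:
  assumes "summable (\<lambda>n. (cmod (x n))\<^sup>2)" "summable (\<lambda>n. (cmod (y n))\<^sup>2)"
  shows "summable (\<lambda>n. (cmod (x n + y n))\<^sup>2)"
proof (rule summable_comparison_test)
  show "summable (\<lambda>n. 2 * (cmod (x n))\<^sup>2 + 2 * (cmod (y n))\<^sup>2)"
    using assms by (intro summable_add summable_mult)
  have "(cmod (a + b))\<^sup>2 \<le> 2 * (cmod a)\<^sup>2 + 2 * (cmod b)\<^sup>2" for a b
  proof -
    have "(cmod (a + b))\<^sup>2 \<le> (cmod a + cmod b)\<^sup>2"
      by (intro power_mono norm_triangle_ineq) simp
    also have "\<dots> \<le> 2 * (cmod a)\<^sup>2 + 2 * (cmod b)\<^sup>2"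
      using zero_le_power2[of "cmod a - cmod b"] by (simp add: power2_eq_square algebra_simps)
    finally show ?thesis .
  qed
  thus "\<exists>N. \<forall>n\<ge>N. norm ((cmod (x n + y n))\<^sup>2) \<le> 2 * (cmod (x n))\<^sup>2 + 2 * (cmod (y n))\<^sup>2"
    by simp
qed

lemma square_summable_mult:
  assumes "summable (\<lambda>n. (cmod (x n))\<^sup>2)"
  shows "summable (\<lambda>n. (cmod (c * x n))\<^sup>2)"
  using summable_mult[OF assms, of "(cmod c)\<^sup>2"] by (simp add: norm_mult power_mult_distrib)

lemma square_summable_prod:
  assumes "summable (\<lambda>n. (cmod (x n))\<^sup>2)" "summable (\<lambda>n. (cmod (y n))\<^sup>2)"
  shows "summable (\<lambda>n. x n * cnj (y n))"
proof (rule summable_norm_cancel, rule summable_comparison_test)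
  show "summable (\<lambda>n. (cmod (x n))\<^sup>2 + (cmod (y n))\<^sup>2)"
    using assms by (rule summable_add)
  have "cmod (a * cnj b) \<le> (cmod a)\<^sup>2 + (cmod b)\<^sup>2" for a b
  proof -
    have "2 * (cmod a * cmod b) \<le> (cmod a)\<^sup>2 + (cmod b)\<^sup>2"
      using sum_squares_bound[of "cmod a" "cmod b"] by (simp add: mult.assoc)
    moreover have "0 \<le> cmod a * cmod b" by simp
    ultimately show ?thesis unfolding norm_mult complex_mod_cnj by linarith
  qed
  thus "\<exists>N. \<forall>n\<ge>N. norm (norm (x n * cnj (y n))) \<le> (cmod (x n))\<^sup>2 + (cmod (y n))\<^sup>2"
    by simp
qed

instantiation ell2 :: real_vector
begin

lift_definition zero_ell2 :: ell2 is "\<lambda>_. 0" by simp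
lift_definition plus_ell2 :: "ell2 \<Rightarrow> ell2 \<Rightarrow> ell2" is "\<lambda>x y n. x n + y n"
  by (rule square_summable_add)
lift_definition uminus_ell2 :: "ell2 \<Rightarrow> ell2" is "\<lambda>x n. - x n" by simp
lift_definition minus_ell2 :: "ell2 \<Rightarrow> ell2 \<Rightarrow> ell2" is "\<lambda>x y n. x n - y n"
  subgoal for x y using square_summable_add[of x "\<lambda>n. - y n"] by simp
  done
lift_definition scaleR_ell2 :: "real \<Rightarrow> ell2 \<Rightarrow> ell2" is "\<lambda>r x n. complex_of_real r * x n"
  by (rule square_summable_mult)

instance
  by standard (transfer; simp add: fun_eq_iff algebra_simps)+

end

lift_definition ell2_inner :: "ell2 \<Rightarrow> ell2 \<Rightarrow> complex" is "\<lambda>x y. \<Sum>n. x n * cnj (y n)" .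

lemma ell2_inner_commute: "ell2_inner x y = cnj (ell2_inner y x)"
proof transfer
  fix x y :: "nat \<Rightarrow> complex"
  assume *: "summable (\<lambda>n. (cmod (x n))\<^sup>2)" "summable (\<lambda>n. (cmod (y n))\<^sup>2)"
  have "(\<lambda>n. y n * cnj (x n)) sums (\<Sum>n. y n * cnj (x n))"
    using square_summable_prod[OF *(2) *(1)] by (rule summable_sums)
  hence "(\<lambda>n. cnj (y n * cnj (x n))) sums cnj (\<Sum>n. y n * cnj (x n))"
    by (simp only: sums_cnj)
  thus "(\<Sum>n. x n * cnj (y n)) = cnj (\<Sum>n. y n * cnj (x n))"
    by (simp add: sums_iff mult.commute)
qed

lemma ell2_inner_add: "ell2_inner (x + y) z = ell2_inner x z + ell2_inner y z"
  by transfer (simp add: suminf_add square_summable_prod distrib_right)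

lemma ell2_inner_scaleR: "ell2_inner (r *\<^sub>R x) y = complex_of_real r * ell2_inner x y"
  by transfer (simp add: suminf_mult square_summable_prod mult.assoc)

lemma ell2_inner_self:
  "ell2_inner x x = complex_of_real (\<Sum>n. (cmod (Rep_ell2 x n))\<^sup>2)"
proof transfer
  fix x :: "nat \<Rightarrow> complex"
  assume "summable (\<lambda>n. (cmod (x n))\<^sup>2)"
  hence "(\<lambda>n. complex_of_real ((cmod (x n))\<^sup>2)) sums complex_of_real (\<Sum>n. (cmod (x n))\<^sup>2)"
    by (intro sums_of_real summable_sums)
  thus "(\<Sum>n. x n * cnj (x n)) = complex_of_real (\<Sum>n. (cmod (x n))\<^sup>2)"
    by (simp only: complex_norm_square sums_iff)
qed

lemma summable_Rep_ell2: "summable (\<lambda>n. (cmod (Rep_ell2 x n))\<^sup>2)"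
  using Rep_ell2[of x] by simp

instantiation ell2 :: real_inner
begin

definition inner_ell2 :: "ell2 \<Rightarrow> ell2 \<Rightarrow> real"
  where "inner_ell2 x y = Re (ell2_inner x y)"
definition norm_ell2 :: "ell2 \<Rightarrow> real"
  where "norm_ell2 x = sqrt (inner x x)"
definition dist_ell2 :: "ell2 \<Rightarrow> ell2 \<Rightarrow> real"
  where "dist_ell2 x y = norm (x - y)"
definition sgn_ell2 :: "ell2 \<Rightarrow> ell2"
  where "sgn_ell2 x = x /\<^sub>R norm x"
definition uniformity_ell2 :: "(ell2 \<times> ell2) filter"
  where "uniformity_ell2 = (INF e\<in>{0<..}. principal {(x, y). dist x y < e})"
definition open_ell2 :: "ell2 set \<Rightarrow> bool"
  where "open_ell2 U \<longleftrightarrow> (\<forall>x\<in>U. \<forall>\<^sub>F (x', y) in uniformity. x' = x \<longrightarrow> y \<in> U)"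

instance
proof
  fix x y z :: ell2 and r :: real
  show "inner x y = inner y x"
    unfolding inner_ell2_def by (subst ell2_inner_commute) simp
  show "inner (x + y) z = inner x z + inner y z"
    by (simp add: inner_ell2_def ell2_inner_add)
  show "inner (r *\<^sub>R x) y = r * inner x y"
    by (simp add: inner_ell2_def ell2_inner_scaleR)
  show "0 \<le> inner x x"
    by (simp add: inner_ell2_def ell2_inner_self suminf_nonneg summable_Rep_ell2)
  have "inner x x = 0 \<longleftrightarrow> (\<forall>n. Rep_ell2 x n = 0)"
    by (simp add: inner_ell2_def ell2_inner_self suminf_eq_zero_iff summable_Rep_ell2)
  also have "\<dots> \<longleftrightarrow> x = 0"
    by transfer (simp add: fun_eq_iff)
  finally show "inner x x = 0 \<longleftrightarrow> x = 0" .
qed (simp_all only: norm_ell2_def dist_ell2_def sgn_ell2_def uniformity_ell2_def open_ell2_def)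

end

lemma norm_ell2_square: "(norm x)\<^sup>2 = (\<Sum>n. (cmod (Rep_ell2 x n))\<^sup>2)"
  by (simp add: power2_norm_eq_inner inner_ell2_def ell2_inner_self)

lemma sum_le_norm_ell2: "(\<Sum>n<N. (cmod (Rep_ell2 x n))\<^sup>2) \<le> (norm x)\<^sup>2"
  unfolding norm_ell2_square by (intro sum_le_suminf summable_Rep_ell2) auto

lemma Rep_ell2_diff: "Rep_ell2 (x - y) n = Rep_ell2 x n - Rep_ell2 y n"
  by transfer simp

lemma cmod_Rep_ell2_le: "cmod (Rep_ell2 x n) \<le> norm x"
proof (rule power2_le_imp_le)
  have "(cmod (Rep_ell2 x n))\<^sup>2 \<le> (\<Sum>k<Suc n. (cmod (Rep_ell2 x k))\<^sup>2)"
    by (rule member_le_sum) auto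
  thus "(cmod (Rep_ell2 x n))\<^sup>2 \<le> (norm x)\<^sup>2"
    using sum_le_norm_ell2 by (rule order_trans)
qed simp

instance ell2 :: complete_space
proof
  fix X :: "nat \<Rightarrow> ell2"
  assume X: "Cauchy X"
  have "Cauchy (\<lambda>k. Rep_ell2 (X k) n)" for n
  proof (rule metric_CauchyI)
    fix e :: real assume "e > 0"
    then obtain M where M: "\<forall>m\<ge>M. \<forall>k\<ge>M. dist (X m) (X k) < e"
      using metric_CauchyD[OF X] by blast
    have "dist (Rep_ell2 (X m) n) (Rep_ell2 (X k) n) \<le> dist (X m) (X k)" for m k
      using cmod_Rep_ell2_le[of "X m - X k" n] by (simp add: dist_norm Rep_ell2_diff)
    thus "\<exists>M. \<forall>m\<ge>M. \<forall>k\<ge>M. dist (Rep_ell2 (X m) n) (Rep_ell2 (X k) n) < e"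
      using M by (meson le_less_trans)
  qed
  hence "\<forall>n. \<exists>l. (\<lambda>k. Rep_ell2 (X k) n) \<longlonglongrightarrow> l"
    by (simp add: Cauchy_convergent_iff convergent_def)
  then obtain y where y: "\<And>n. (\<lambda>k. Rep_ell2 (X k) n) \<longlonglongrightarrow> y n"
    by metis
  have bound: "summable (\<lambda>n. (cmod (Rep_ell2 (X m) n - y n))\<^sup>2) \<and>
      (\<Sum>n. (cmod (Rep_ell2 (X m) n - y n))\<^sup>2) \<le> e\<^sup>2"
    if M: "\<forall>k\<ge>M. dist (X m) (X k) < e" and "e > 0" for m M e
  proof -
    have *: "(\<Sum>n<N. (cmod (Rep_ell2 (X m) n - y n))\<^sup>2) \<le> e\<^sup>2" for N
    proof (rule LIMSEQ_le_const2)
      show "(\<lambda>k. \<Sum>n<N. (cmod (Rep_ell2 (X m) n - Rep_ell2 (X k) n))\<^sup>2)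
              \<longlonglongrightarrow> (\<Sum>n<N. (cmod (Rep_ell2 (X m) n - y n))\<^sup>2)"
        by (intro tendsto_intros y)
      have "(\<Sum>n<N. (cmod (Rep_ell2 (X m) n - Rep_ell2 (X k) n))\<^sup>2) \<le> e\<^sup>2" if "k \<ge> M" for k
      proof -
        have "(\<Sum>n<N. (cmod (Rep_ell2 (X m) n - Rep_ell2 (X k) n))\<^sup>2) \<le> (norm (X m - X k))\<^sup>2"
          using sum_le_norm_ell2[where x = "X m - X k" and N = N] by (simp add: Rep_ell2_diff)
        also have "\<dots> \<le> e\<^sup>2"
          using M that by (intro power_mono) (auto simp: dist_norm intro: less_imp_le)
        finally show ?thesis .
      qed
      thus "\<exists>K. \<forall>k\<ge>K. (\<Sum>n<N. (cmod (Rep_ell2 (X m) n - Rep_ell2 (X k) n))\<^sup>2) \<le> e\<^sup>2"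
        by blast
    qed
    have s: "summable (\<lambda>n. (cmod (Rep_ell2 (X m) n - y n))\<^sup>2)"
      by (rule summableI_nonneg_bounded[OF _ *]) simp
    show ?thesis
      using s suminf_le_const[OF s] * by blast
  qed
  obtain M where M: "\<forall>m\<ge>M. \<forall>k\<ge>M. dist (X m) (X k) < 1"
    using metric_CauchyD[OF X, of 1] by auto
  have "summable (\<lambda>n. (cmod (Rep_ell2 (X M) n - y n))\<^sup>2)"
    using bound[of M M 1] M by auto
  from square_summable_add[OF summable_Rep_ell2[of "X M"] square_summable_mult[OF this, of "-1"]]
  have "summable (\<lambda>n. (cmod (y n))\<^sup>2)"
    by simp
  then obtain Y where Y: "Rep_ell2 Y = y"
    using Abs_ell2_inverse by blast
  have "X \<longlonglongrightarrow> Y"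
  proof (rule metric_LIMSEQ_I)
    fix e :: real assume "e > 0"
    then obtain M where M: "\<forall>m\<ge>M. \<forall>k\<ge>M. dist (X m) (X k) < e / 2"
      using metric_CauchyD[OF X, of "e / 2"] by auto
    have "dist (X m) Y < e" if "m \<ge> M" for m
    proof -
      have "(norm (X m - Y))\<^sup>2 \<le> (e / 2)\<^sup>2"
        unfolding norm_ell2_square Rep_ell2_diff Y
        using bound[of M m "e / 2"] M that \<open>e > 0\<close> by auto
      hence "norm (X m - Y) \<le> e / 2"
        by (rule power2_le_imp_le) (use \<open>e > 0\<close> in simp)
      thus ?thesis
        using \<open>e > 0\<close> by (simp add: dist_norm)
    qed
    thus "\<exists>M. \<forall>m\<ge>M. dist (X m) Y < e" by blast
  qed
  thus "convergent X" by (auto simp: convergent_def)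
qed

instantiation ell2 :: complex_hilbert
begin

lift_definition scaleC_ell2 :: "complex \<Rightarrow> ell2 \<Rightarrow> ell2" is "\<lambda>c x n. c * x n"
  by (rule square_summable_mult)

definition cinner_ell2 :: "ell2 \<Rightarrow> ell2 \<Rightarrow> complex"
  where "cinner_ell2 = ell2_inner"

instance
proof
  fix x y z :: ell2 and c d :: complex and r :: real
  show "c *\<^sub>C (x + y) = c *\<^sub>C x + c *\<^sub>C y" "(c + d) *\<^sub>C x = c *\<^sub>C x + d *\<^sub>C x"
    "c *\<^sub>C d *\<^sub>C x = (c * d) *\<^sub>C x" "complex_of_real r *\<^sub>C x = r *\<^sub>R x"
    by (transfer; simp add: algebra_simps)+
  show "cinner x y = cnj (cinner y x)"
    unfolding cinner_ell2_def by (rule ell2_inner_commute)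
  show "cinner (x + y) z = cinner x z + cinner y z"
    by (simp add: cinner_ell2_def ell2_inner_add)
  show "cinner (c *\<^sub>C x) y = c * cinner x y"
    unfolding cinner_ell2_def
    by transfer (simp add: suminf_mult square_summable_prod mult.assoc)
  show "Re (cinner x y) = inner x y"
    by (simp add: cinner_ell2_def inner_ell2_def)
qed

end


section \<open>Operators, trace class and Fredholm determinants\<close>

definition bounded_clinear :: "('a::complex_hilbert \<Rightarrow> 'b::complex_hilbert) \<Rightarrow> bool"
  where "bounded_clinear T \<longleftrightarrow>
    bounded_linear T \<and> (\<forall>c v. T (c *\<^sub>C v) = c *\<^sub>C T v)"

text \<open>\<open>op_exp A x\<close> is $e^{xA}$.\<close>

definition op_exp :: "('h::complex_hilbert \<Rightarrow> 'h) \<Rightarrow> complex \<Rightarrow> 'h \<Rightarrow> 'h"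
  where "op_exp A x v = (\<Sum>n. (x ^ n / fact n) *\<^sub>C (A ^^ n) v)"

definition orthonormal_basis :: "'h::complex_hilbert set \<Rightarrow> bool"
  where "orthonormal_basis S \<longleftrightarrow>
    (\<forall>e\<in>S. \<forall>f\<in>S. cinner e f = (if e = f then 1 else 0)) \<and>
    (\<forall>v. (\<forall>e\<in>S. cinner v e = 0) \<longrightarrow> v = 0)"

text \<open>
  \<open>T\<close> is trace class if the trace of $|T| = (T^*T)^{1/2}$ is finite in some (equivalently,
  any) orthonormal basis. The operator \<open>P\<close> below is $|T|$: it is the positive operator with
  $\langle P^2 v, w\rangle = \langle Pv, Pw\rangle = \langle Tv, Tw\rangle = \langle T^*Tv, w\rangle$.
\<close>

definition trace_class :: "('h::complex_hilbert \<Rightarrow> 'h) \<Rightarrow> bool"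
  where "trace_class T \<longleftrightarrow> bounded_clinear T \<and>
    (\<exists>P S. bounded_clinear P \<and>
       (\<forall>v. cinner (P v) v \<in> \<real> \<and> 0 \<le> Re (cinner (P v) v)) \<and>
       (\<forall>v w. cinner (P v) (P w) = cinner (T v) (T w)) \<and>
       orthonormal_basis S \<and> (\<lambda>e. Re (cinner (P e) e)) summable_on S)"

text \<open>
  Fredholm's expansion $\det(I+T) = \sum_k \mathrm{tr}(\Lambda^k T)$: the vectors
  $e_1\wedge\dots\wedge e_k$ with $\{e_1,\dots,e_k\}\subseteq S$ form an orthonormal basis of
  $\Lambda^k H$, and the diagonal entry of $\Lambda^k T$ there is the principal minor of \<open>T\<close>
  over $\{e_1,\dots,e_k\}$. For trace class \<open>T\<close> the sum converges absolutely and its value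
  does not depend on \<open>S\<close>.
\<close>

definition principal_minor :: "('h::complex_hilbert \<Rightarrow> 'h) \<Rightarrow> 'h set \<Rightarrow> complex"
  where "principal_minor T F =
    (\<Sum>p | p permutes F. of_int (sign p) * (\<Prod>e\<in>F. cinner (T (p e)) e))"

definition has_fredholm_det :: "('h::complex_hilbert \<Rightarrow> 'h) \<Rightarrow> complex \<Rightarrow> bool"
  where "has_fredholm_det T d \<longleftrightarrow>
    (\<exists>S. orthonormal_basis S \<and>
       (principal_minor T has_sum d) {F. finite F \<and> F \<subseteq> S})"


section \<open>Tau functions of linear systems\<close>

definition periodic_group :: "('h::complex_hilbert \<Rightarrow> 'h) \<Rightarrow> bool"
  where "periodic_group A \<longleftrightarrow>
    (\<exists>T>0. \<forall>x::real. op_exp A (of_real (x + T)) = op_exp A (of_real x))"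

text \<open>
  The group is periodic in the real time variable; since \<open>A\<close> is bounded, the tau function
  makes sense for complex \<open>x\<close> as well, and \<open>\<tau>\<close> is this entire function.
  The type arguments are the state space $H$ and the auxiliary space $H_0$.
\<close>

definition uniformly_periodic_tau ::
    "'h::complex_hilbert itself \<Rightarrow> 'k::complex_hilbert itself \<Rightarrow> (complex \<Rightarrow> complex) \<Rightarrow> bool"
  where "uniformly_periodic_tau _ _ \<tau> \<longleftrightarrow>
    (\<exists>(A :: 'h \<Rightarrow> 'h) (B :: 'k \<Rightarrow> 'h) (C :: 'h \<Rightarrow> 'k) (E :: 'h \<Rightarrow> 'h).
       bounded_clinear A \<and> bounded_clinear B \<and> bounded_clinear C \<and>
       periodic_group A \<and> trace_class E \<and>
       (\<forall>v. A (E v) + E (A v) = B (C v)) \<and>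
       (\<forall>x. has_fredholm_det (op_exp A x \<circ> E \<circ> op_exp A x) (\<tau> x)))"

definition finite_dim_tau :: "(complex \<Rightarrow> complex) \<Rightarrow> bool"
  where "finite_dim_tau \<tau> \<longleftrightarrow>
    (\<exists>n m A B C (R :: complex \<Rightarrow> complex mat).
       A \<in> carrier_mat n n \<and> B \<in> carrier_mat n m \<and> C \<in> carrier_mat m n \<and>
       (\<forall>x. R x \<in> carrier_mat n n) \<and>
       (\<forall>x. \<forall>i<n. \<forall>j<n.
          ((\<lambda>x. R x $$ (i, j)) has_field_derivative (- (A * R x + R x * A)) $$ (i, j)) (at x)) \<and>
       A * R 0 + R 0 * A = B * C \<and>
       (\<forall>x. \<tau> x = Determinant.det (1\<^sub>m n + R x)))"

text \<open>
  One tau function of each kind in the numerator and in the denominator suffices: products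
  (of tau functions with a common period, in the periodic case) are tau functions of direct
  sums, and the constant 1 is a tau function of either kind.
\<close>

definition tau_quotient :: "(complex \<Rightarrow> complex) \<Rightarrow> bool"
  where "tau_quotient f \<longleftrightarrow>
    (\<exists>\<tau>\<^sub>1 \<tau>\<^sub>2 \<sigma>\<^sub>1 \<sigma>\<^sub>2.
       uniformly_periodic_tau TYPE(ell2) TYPE(ell2) \<tau>\<^sub>1 \<and>
       uniformly_periodic_tau TYPE(ell2) TYPE(ell2) \<tau>\<^sub>2 \<and>
       finite_dim_tau \<sigma>\<^sub>1 \<and> finite_dim_tau \<sigma>\<^sub>2 \<and>
       (\<forall>\<^sub>\<approx>x. \<tau>\<^sub>2 x * \<sigma>\<^sub>2 x \<noteq> 0 \<and> f x = (\<tau>\<^sub>1 x * \<sigma>\<^sub>1 x) / (\<tau>\<^sub>2 x * \<sigma>\<^sub>2 x)))"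


section \<open>Elliptic functions and Hill's equation\<close>

text \<open>
  Meromorphic functions on the plane are functions that are \<^const>\<open>meromorphic_on\<close>
  \<open>UNIV\<close>, whose values at a discrete closed set of points are irrelevant. Accordingly, identities
  between them are required off such a set, which is expressed by the quantifier
  \<open>\<forall>\<^sub>\<approx>\<close>; by continuity they then hold wherever all functions involved are analytic.
\<close>

definition period_lattice :: "complex \<Rightarrow> complex \<Rightarrow> complex set"
  where "period_lattice \<omega>\<^sub>1 \<omega>\<^sub>2 = {of_int m * (2 * \<omega>\<^sub>1) + of_int n * (2 * \<omega>\<^sub>2) | m n. True}"

definition elliptic_first_kind :: "complex \<Rightarrow> complex \<Rightarrow> (complex \<Rightarrow> complex) \<Rightarrow> bool"
  where "elliptic_first_kind \<omega>\<^sub>1 \<omega>\<^sub>2 f \<longleftrightarrow> f meromorphic_on UNIV \<and>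
    (\<forall>p\<in>period_lattice \<omega>\<^sub>1 \<omega>\<^sub>2. \<forall>\<^sub>\<approx>z. f (z + p) = f z)"

definition elliptic_second_kind :: "complex \<Rightarrow> complex \<Rightarrow> (complex \<Rightarrow> complex) \<Rightarrow> bool"
  where "elliptic_second_kind \<omega>\<^sub>1 \<omega>\<^sub>2 f \<longleftrightarrow> f meromorphic_on UNIV \<and>
    (\<exists>\<rho>\<^sub>1. \<forall>\<^sub>\<approx>z. f (z + 2 * \<omega>\<^sub>1) = \<rho>\<^sub>1 * f z) \<and>
    (\<exists>\<rho>\<^sub>2. \<forall>\<^sub>\<approx>z. f (z + 2 * \<omega>\<^sub>2) = \<rho>\<^sub>2 * f z)"

definition hill_solution ::
    "(complex \<Rightarrow> complex) \<Rightarrow> complex \<Rightarrow> (complex \<Rightarrow> complex) \<Rightarrow> bool"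
  where "hill_solution u \<mu> \<psi> \<longleftrightarrow> \<psi> meromorphic_on UNIV \<and>
    (\<forall>\<^sub>\<approx>z. - deriv (deriv \<psi>) z + u z * \<psi> z = \<mu> * \<psi> z)"

definition hill_fundamental_system ::
    "(complex \<Rightarrow> complex) \<Rightarrow> complex \<Rightarrow> (complex \<Rightarrow> complex) \<Rightarrow> (complex \<Rightarrow> complex) \<Rightarrow> bool"
  where "hill_fundamental_system u \<mu> \<psi>\<^sub>1 \<psi>\<^sub>2 \<longleftrightarrow>
    hill_solution u \<mu> \<psi>\<^sub>1 \<and> hill_solution u \<mu> \<psi>\<^sub>2 \<and>
    (\<forall>a b. (\<forall>\<^sub>\<approx>z. a * \<psi>\<^sub>1 z + b * \<psi>\<^sub>2 z = 0) \<longrightarrow> a = 0 \<and> b = 0)"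

text \<open>
  Tau functions of uniformly periodic systems have a real period, whereas \<open>\<Lambda>\<close> need not
  contain a nonzero real number. A direction \<open>c\<close> is rational if the real line
  spanned by \<open>c\<close> contains a nonzero lattice point; \<open>x \<mapsto> \<psi> (c x)\<close> then has
  Floquet multipliers in the real variable \<open>x\<close>. The numbers \<open>\<omega>\<^sub>1\<close> and \<open>\<omega>\<^sub>2\<close>
  are always rational directions, and 1 is one iff \<open>\<Lambda>\<close> has a nonzero real element.
\<close>

definition rational_direction :: "complex \<Rightarrow> complex \<Rightarrow> complex \<Rightarrow> bool"
  where "rational_direction \<omega>\<^sub>1 \<omega>\<^sub>2 c \<longleftrightarrow>
    c \<noteq> 0 \<and> (\<exists>t::real. t \<noteq> 0 \<and> of_real t * c \<in> period_lattice \<omega>\<^sub>1 \<omega>\<^sub>2)"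

end

theory Submission
  imports Defs
begin

text \<open>
  Translation by a period of \<open>u\<close> acts on the space of meromorphic solutions of Hill's
  equation. That space is two-dimensional, because the Wronskian of two solutions is constant,
  and the translations by $2\omega_1$ and $2\omega_2$ commute on it, so they have a common
  eigenvector \<open>\<psi>\<close>: this is the elliptic solution of the second kind
  (\<open>hill_common_floquet_solution\<close>).

  Let \<open>c\<close> be a rational direction, so that $l = tc$ is a lattice point for some real
  $t \neq 0$, and choose a lattice point \<open>q\<close> for which $\tau = q/l$ lies in the upper
  half-plane. Then $g(y) = \psi(ly)$ has multipliers for the periods \<open>1\<close> and
  \<open>\<tau>\<close>. The entire function \<open>\<theta>\<close> with
  $\theta(z) = \prod_{n\ge 0} (1 - Q^n w) (1 - Q^{n+1}/w)$, where $w = e^{2\pi i z}$ and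
  $Q = e^{2\pi i\tau}$, vanishes only at lattice points, has a simple zero at \<open>0\<close> and
  satisfies $\theta(z+1) = \theta(z)$ and $\theta(z+\tau) = -w^{-1}\theta(z)$. Dividing \<open>g\<close>
  by the product of the factors $\theta(z-a)^{n_a}$, where \<open>a\<close> runs over the zeros and poles
  of \<open>g\<close> in a period cell and $n_a$ is their order, leaves an entire function \<open>G\<close>
  without zeros that is multiplied by a constant under $z \mapsto z+1$ and by an exponential
  $c\,e^{mz}$ under $z \mapsto z+\tau$. The derivative of $G'/G$ is doubly periodic, hence
  constant by Liouville's theorem; as $G'/G$ has period \<open>1\<close>, it is itself constant and
  \<open>G\<close> is an exponential (\<open>second_kind_theta_factorization\<close>).

  It remains to see the factors as tau functions. If $A = \mathrm{diag}(\pm \pi i/t)$ and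
  $E = \mathrm{diag}(e_n)$ with summable $e_n$, then $e^{xA}$ has period $2|t|$ and the Fredholm
  determinant of $I + e^{xA}Ee^{xA}$ is $\prod_n (1 + e_n e^{\pm 2\pi i x/t})$; the functions
  $\theta(x/t - a)$ and their products are of this form
  (\<open>uniformly_periodic_tau_periodic_product\<close>, \<open>periodic_product_theta\<close>). Finally
  $C e^{bx} = C(1+e^{bx})/(1+e^{-bx})$ is a quotient of tau functions of diagonal
  finite-dimensional systems.
\<close>

section \<open>Diagonal operators on square-summable sequences\<close>

instance ell2 :: banach ..

lemma cinner_ell2_eq: "cinner v w = (\<Sum>k. Rep_ell2 v k * cnj (Rep_ell2 w k))"
  unfolding cinner_ell2_def by (rule ell2_inner.rep_eq)

definition diag_op :: "(nat \<Rightarrow> complex) \<Rightarrow> ell2 \<Rightarrow> ell2"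
  where "diag_op a v = Abs_ell2 (\<lambda>n. a n * Rep_ell2 v n)"

definition ell2_unit :: "nat \<Rightarrow> ell2"
  where "ell2_unit n = Abs_ell2 (\<lambda>k. if k = n then 1 else 0)"

lemma ell2_eqI: "(\<And>n. Rep_ell2 x n = Rep_ell2 y n) \<Longrightarrow> x = y"
  by (metis Rep_ell2_inject ext)

lemma Rep_ell2_add: "Rep_ell2 (x + y) n = Rep_ell2 x n + Rep_ell2 y n"
  by transfer simp

lemma Rep_ell2_scaleC: "Rep_ell2 (c *\<^sub>C x) n = c * Rep_ell2 x n"
  by transfer simp

lemma Rep_ell2_scaleR: "Rep_ell2 (c *\<^sub>R x) n = of_real c * Rep_ell2 x n"
  by transfer simp

lemma Rep_ell2_unit: "Rep_ell2 (ell2_unit n) k = (if k = n then 1 else 0)"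
proof -
  have "summable (\<lambda>k. (cmod (if k = n then 1 else 0))\<^sup>2)"
    by (rule summable_finite[of "{n}"]) auto
  thus ?thesis
    unfolding ell2_unit_def by (subst Abs_ell2_inverse) auto
qed

lemma cinner_ell2_unit: "cinner x (ell2_unit n) = Rep_ell2 x n"
proof -
  have "cinner x (ell2_unit n) = (\<Sum>k. Rep_ell2 x k * cnj (Rep_ell2 (ell2_unit n) k))"
    by (rule cinner_ell2_eq)
  also have "\<dots> = (\<Sum>k\<in>{n}. Rep_ell2 x k * cnj (Rep_ell2 (ell2_unit n) k))"
    by (rule suminf_finite) (auto simp: Rep_ell2_unit)
  finally show ?thesis by (simp add: Rep_ell2_unit)
qed

lemma inj_ell2_unit: "inj ell2_unit"
  by (rule injI) (metis Rep_ell2_unit zero_neq_one)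

lemma orthonormal_basis_ell2_unit: "orthonormal_basis (range ell2_unit)"
  unfolding orthonormal_basis_def
  by (auto simp: cinner_ell2_unit Rep_ell2_unit inj_eq[OF inj_ell2_unit] zero_ell2.rep_eq
           intro!: ell2_eqI)

lemma Rep_diag_op:
  assumes "bounded (range a)"
  shows "Rep_ell2 (diag_op a v) n = a n * Rep_ell2 v n"
proof -
  obtain M where M: "\<And>n. cmod (a n) \<le> M"
    using assms by (auto simp: bounded_iff)
  have "summable (\<lambda>n. (cmod (a n * Rep_ell2 v n))\<^sup>2)"
  proof (rule summable_comparison_test')
    show "summable (\<lambda>n. M\<^sup>2 * (cmod (Rep_ell2 v n))\<^sup>2)"
      by (intro summable_mult summable_Rep_ell2)
    show "norm ((cmod (a n * Rep_ell2 v n))\<^sup>2) \<le> M\<^sup>2 * (cmod (Rep_ell2 v n))\<^sup>2" for n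
      using M[of n] by (auto simp: norm_mult power_mult_distrib intro!: mult_right_mono power_mono)
  qed
  thus ?thesis
    unfolding diag_op_def by (subst Abs_ell2_inverse) auto
qed

text \<open>
  This bound gives the continuity of diagonal operators and, applied to powers, the norm
  convergence of the exponential series.
\<close>

lemma norm_diag_op_le:
  assumes "\<And>n. cmod (a n) \<le> M"
  shows "norm (diag_op a v) \<le> M * norm v"
proof (rule power2_le_imp_le)
  have bdd: "bounded (range a)"
    using assms by (auto simp: bounded_iff)
  have "0 \<le> M" using assms[of 0] norm_ge_zero order_trans by blast
  thus "0 \<le> M * norm v" by simp
  have "(norm (diag_op a v))\<^sup>2 = (\<Sum>n. (cmod (a n * Rep_ell2 v n))\<^sup>2)"
    by (simp add: norm_ell2_square Rep_diag_op[OF bdd])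
  also have "\<dots> \<le> (\<Sum>n. M\<^sup>2 * (cmod (Rep_ell2 v n))\<^sup>2)"
  proof (rule suminf_le)
    show "(cmod (a n * Rep_ell2 v n))\<^sup>2 \<le> M\<^sup>2 * (cmod (Rep_ell2 v n))\<^sup>2" for n
      using assms[of n] by (auto simp: norm_mult power_mult_distrib intro!: mult_right_mono power_mono)
    show "summable (\<lambda>n. M\<^sup>2 * (cmod (Rep_ell2 v n))\<^sup>2)"
      by (intro summable_mult summable_Rep_ell2)
    show "summable (\<lambda>n. (cmod (a n * Rep_ell2 v n))\<^sup>2)"
      using summable_Rep_ell2[of "diag_op a v"] by (simp add: Rep_diag_op[OF bdd])
  qed
  also have "\<dots> = (M * norm v)\<^sup>2"
    by (simp add: suminf_mult[OF summable_Rep_ell2] norm_ell2_square power_mult_distrib)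
  finally show "(norm (diag_op a v))\<^sup>2 \<le> (M * norm v)\<^sup>2" .
qed

lemma bounded_clinear_diag_op:
  assumes "bounded (range a)"
  shows "bounded_clinear (diag_op a)"
proof -
  obtain M where M: "\<And>n. cmod (a n) \<le> M"
    using assms by (auto simp: bounded_iff)
  have "bounded_linear (diag_op a)"
    by (rule bounded_linear_intro[where K = M])
       (auto intro!: ell2_eqI norm_diag_op_le[OF M, THEN order_trans]
             simp: Rep_diag_op[OF assms] Rep_ell2_add Rep_ell2_scaleR algebra_simps)
  thus ?thesis
    unfolding bounded_clinear_def
    by (auto intro!: ell2_eqI simp: Rep_diag_op[OF assms] Rep_ell2_scaleC)
qed

lemma bounded_range_mult:
  fixes a b :: "nat \<Rightarrow> complex"
  assumes "bounded (range a)" "bounded (range b)"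
  shows "bounded (range (\<lambda>n. a n * b n))"
proof -
  obtain M N where M: "\<And>n. cmod (a n) \<le> M" and N: "\<And>n. cmod (b n) \<le> N"
    using assms by (auto simp: bounded_iff)
  have "cmod (a n * b n) \<le> M * N" for n
    unfolding norm_mult using M[of n] N[of n]
    by (meson mult_mono norm_ge_zero order_trans)
  thus ?thesis by (auto simp: bounded_iff)
qed

lemma diag_op_comp:
  assumes "bounded (range a)" "bounded (range b)"
  shows "diag_op a \<circ> diag_op b = diag_op (\<lambda>n. a n * b n)"
  by (auto intro!: ext ell2_eqI simp: Rep_diag_op assms bounded_range_mult mult.assoc)

lemma bounded_clinear_id: "bounded_clinear (\<lambda>v. v)"
  unfolding bounded_clinear_def by (simp add: bounded_linear_ident)

lemma bounded_linear_Rep_ell2: "bounded_linear (\<lambda>v. Rep_ell2 v k)"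
  by (rule bounded_linear_intro[where K = 1])
     (auto simp: Rep_ell2_add Rep_ell2_scaleR scaleR_conv_of_real cmod_Rep_ell2_le)

text \<open>
  The exponential series converges absolutely in \<open>ell2\<close>, and each coordinate is a bounded
  linear functional, so the sum may be computed coordinate by coordinate, where it is the scalar
  exponential series.
\<close>

lemma op_exp_diag_op:
  assumes "bounded (range a)"
  shows "op_exp (diag_op a) x = diag_op (\<lambda>n. exp (x * a n))"
proof
  fix v
  obtain M where M: "\<And>n. cmod (a n) \<le> M"
    using assms by (auto simp: bounded_iff)
  have pow: "(diag_op a ^^ m) v = diag_op (\<lambda>n. a n ^ m) v \<and> bounded (range (\<lambda>n. a n ^ m))" for m
  proof (induction m)
    case 0
    have "bounded (range (\<lambda>n::nat. 1::complex))" by (simp add: image_constant_conv)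
    thus ?case by (auto intro!: ell2_eqI simp: Rep_diag_op)
  next
    case (Suc m)
    have b: "bounded (range (\<lambda>n. a n ^ Suc m))"
      using bounded_range_mult[OF assms, of "\<lambda>n. a n ^ m"] Suc by simp
    with Suc show ?case
      by (auto intro!: ell2_eqI simp: Rep_diag_op assms mult.assoc simp del: power_Suc)
         (simp add: mult.assoc)
  qed
  have bexp: "bounded (range (\<lambda>n. exp (x * a n)))"
    unfolding bounded_iff
  proof (intro exI ballI)
    fix y assume "y \<in> range (\<lambda>n. exp (x * a n))"
    then obtain n where "y = exp (x * a n)" by auto
    have "cmod y \<le> exp (cmod (x * a n))" unfolding \<open>y = _\<close> by (rule norm_exp)
    also have "\<dots> \<le> exp (cmod x * M)"
      using M[of n] by (simp add: norm_mult mult_left_mono)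
    finally show "cmod y \<le> exp (cmod x * M)" .
  qed
  have Mpow: "cmod (a n ^ m) \<le> M ^ m" for n m
    unfolding norm_power by (intro power_mono M norm_ge_zero)
  have Rpow: "Rep_ell2 ((diag_op a ^^ m) v) k = a k ^ m * Rep_ell2 v k" for m k
    using pow[of m] by (simp add: Rep_diag_op)
  have norm_scaleC: "norm (c *\<^sub>C w) \<le> cmod c * norm w" for c and w :: ell2
  proof -
    have "c *\<^sub>C w = diag_op (\<lambda>_. c) w"
      by (intro ell2_eqI) (simp add: Rep_diag_op image_constant_conv Rep_ell2_scaleC)
    thus ?thesis using norm_diag_op_le[of "\<lambda>_. c" "cmod c" w] by simp
  qed
  have "summable (\<lambda>m. (x ^ m / fact m) *\<^sub>C (diag_op a ^^ m) v)"
  proof (rule summable_norm_cancel, rule summable_comparison_test')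
    show "summable (\<lambda>m. (cmod x * M) ^ m /\<^sub>R fact m * norm v)"
      by (intro summable_mult2 summable_exp_generic)
    fix m :: nat
    have "norm ((x ^ m / fact m) *\<^sub>C (diag_op a ^^ m) v)
            \<le> cmod (x ^ m / fact m) * norm ((diag_op a ^^ m) v)"
      by (rule norm_scaleC)
    also have "\<dots> \<le> cmod (x ^ m / fact m) * (M ^ m * norm v)"
      using norm_diag_op_le[where a = "\<lambda>n. a n ^ m" and M = "M ^ m", OF Mpow] pow[of m] by (intro mult_left_mono) auto
    finally show "norm (norm ((x ^ m / fact m) *\<^sub>C (diag_op a ^^ m) v)) \<le> (cmod x * M) ^ m /\<^sub>R fact m * norm v"
      by (simp add: norm_divide norm_power power_mult_distrib field_simps)
  qed
  hence S: "(\<lambda>m. (x ^ m / fact m) *\<^sub>C (diag_op a ^^ m) v) sums op_exp (diag_op a) x v"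
    unfolding op_exp_def by (rule summable_sums)
  show "op_exp (diag_op a) x v = diag_op (\<lambda>n. exp (x * a n)) v"
  proof (rule ell2_eqI)
    fix k
    have "(\<lambda>m. Rep_ell2 ((x ^ m / fact m) *\<^sub>C (diag_op a ^^ m) v) k) sums Rep_ell2 (op_exp (diag_op a) x v) k"
      by (rule bounded_linear.sums[OF bounded_linear_Rep_ell2 S])
    hence 1: "(\<lambda>m. (x * a k) ^ m /\<^sub>R fact m * Rep_ell2 v k) sums Rep_ell2 (op_exp (diag_op a) x v) k"
      by (simp add: Rep_ell2_scaleC Rpow power_mult_distrib scaleR_conv_of_real field_simps)
    have 2: "(\<lambda>m. (x * a k) ^ m /\<^sub>R fact m * Rep_ell2 v k) sums (exp (x * a k) * Rep_ell2 v k)"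
      by (intro sums_mult2 exp_converges)
    show "Rep_ell2 (op_exp (diag_op a) x v) k = Rep_ell2 (diag_op (\<lambda>n. exp (x * a n)) v) k"
      using sums_unique2[OF 1 2] by (simp add: Rep_diag_op[OF bexp])
  qed
qed

lemma bounded_range_summable:
  fixes d :: "nat \<Rightarrow> complex"
  assumes "summable (\<lambda>n. cmod (d n))"
  shows "bounded (range d)"
  by (metis assms convergent_imp_Bseq Bseq_eq_bounded summable_norm_cancel summable_LIMSEQ_zero convergent_def)

text \<open>
  The absolute value of a diagonal operator is the diagonal operator of the absolute values of
  its entries, whose trace in the standard basis is the sum of these absolute values.
\<close>

lemma trace_class_diag_op:
  assumes "summable (\<lambda>n. cmod (d n))"
  shows "trace_class (diag_op d)"
proof -
  have b: "bounded (range d)" using assms by (rule bounded_range_summable)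
  hence b': "bounded (range (\<lambda>n. complex_of_real (cmod (d n))))"
    by (simp add: bounded_iff)
  let ?P = "diag_op (\<lambda>n. complex_of_real (cmod (d n)))"
  have pos: "cinner (?P v) v \<in> \<real> \<and> 0 \<le> Re (cinner (?P v) v)" for v
  proof -
    have "complex_of_real (cmod (d n)) * Rep_ell2 v n * cnj (Rep_ell2 v n)
            = complex_of_real (cmod (d n) * (cmod (Rep_ell2 v n))\<^sup>2)" for n
      by (simp add: complex_norm_square mult.assoc del: of_real_power)
    hence eq: "Rep_ell2 (?P v) n * cnj (Rep_ell2 v n) = complex_of_real (cmod (d n) * (cmod (Rep_ell2 v n))\<^sup>2)" for n
      by (simp add: Rep_diag_op[OF b'])
    have "summable (\<lambda>n. complex_of_real (cmod (d n) * (cmod (Rep_ell2 v n))\<^sup>2))"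
      using square_summable_prod[OF summable_Rep_ell2 summable_Rep_ell2, of "?P v" v]
      unfolding eq .
    hence "summable (\<lambda>n. cmod (d n) * (cmod (Rep_ell2 v n))\<^sup>2)"
      by (simp only: summable_of_real_iff)
    hence "(\<lambda>n. complex_of_real (cmod (d n) * (cmod (Rep_ell2 v n))\<^sup>2)) sums
            of_real (\<Sum>n. cmod (d n) * (cmod (Rep_ell2 v n))\<^sup>2)"
       and "0 \<le> (\<Sum>n. cmod (d n) * (cmod (Rep_ell2 v n))\<^sup>2)"
      by (auto intro!: sums_of_real suminf_nonneg simp del: of_real_mult)
    moreover from this have "cinner (?P v) v = of_real (\<Sum>n. cmod (d n) * (cmod (Rep_ell2 v n))\<^sup>2)"
      unfolding cinner_ell2_eq eq by (simp only: sums_iff)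
    ultimately show ?thesis by (simp del: of_real_mult)
  qed
  have same: "cinner (?P v) (?P w) = cinner (diag_op d v) (diag_op d w)" for v w
  proof -
    have "complex_of_real (cmod (d n)) * complex_of_real (cmod (d n)) = d n * cnj (d n)" for n
      by (metis complex_norm_square of_real_mult power2_eq_square)
    hence eq: "(complex_of_real (cmod (d n)) * Rep_ell2 v n) * cnj (complex_of_real (cmod (d n)) * Rep_ell2 w n)
        = (d n * Rep_ell2 v n) * cnj (d n * Rep_ell2 w n)" for n
      by (simp add: mult_ac)
    thus ?thesis
      by (simp only: cinner_ell2_eq Rep_diag_op[OF b'] Rep_diag_op[OF b] eq)
  qed
  have "(\<lambda>e. Re (cinner (?P e) e)) summable_on range ell2_unit"
  proof (subst summable_on_reindex[OF inj_ell2_unit])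
    have "((\<lambda>e. Re (cinner (?P e) e)) \<circ> ell2_unit) = (\<lambda>n. cmod (d n))"
      by (auto simp: cinner_ell2_unit Rep_diag_op[OF b'] Rep_ell2_unit)
    thus "((\<lambda>e. Re (cinner (?P e) e)) \<circ> ell2_unit) summable_on UNIV"
      using assms by (simp add: summable_on_UNIV_nonneg_real_iff)
  qed
  thus ?thesis
    unfolding trace_class_def
    using bounded_clinear_diag_op[OF b] bounded_clinear_diag_op[OF b'] pos same
      orthonormal_basis_ell2_unit by blast
qed


section \<open>Fredholm determinants and periodic tau functions\<close>

lemma convergent_prod_1_plus:
  fixes d :: "nat \<Rightarrow> complex"
  assumes "summable (\<lambda>n. cmod (d n))"
  shows "convergent_prod (\<lambda>n. 1 + d n)"
  using assms by (intro abs_convergent_prod_imp_convergent_prod summable_imp_abs_convergent_prod) simp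

lemma prodinf_1_plus_LIMSEQ:
  fixes d :: "nat \<Rightarrow> complex"
  assumes "summable (\<lambda>n. cmod (d n))"
  shows "(\<lambda>N. \<Prod>n<N. 1 + d n) \<longlonglongrightarrow> (\<Prod>n. 1 + d n)"
  using has_prod_imp_tendsto'[OF convergent_prod_has_prod[OF convergent_prod_1_plus[OF assms]]] .

text \<open>
  Expanding the partial product over \<open>n < N\<close> gives the sum over all subsets of
  $\{0,\dots,N-1\}$. The same expansion with absolute values bounds every finite partial sum by
  $\exp(\sum_n |d_n|)$, so the sum over all finite sets converges absolutely and may be evaluated
  along these power sets, which exhaust the finite sets.
\<close>

lemma has_sum_prod_finite_subsets:
  fixes d :: "nat \<Rightarrow> complex"
  assumes "summable (\<lambda>n. cmod (d n))"
  shows "((\<lambda>N. \<Prod>n\<in>N. d n) has_sum (\<Prod>n. 1 + d n)) (Collect finite)"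
proof -
  have expand: "(\<Prod>n<K. 1 + g n) = (\<Sum>N\<in>Pow {..<K}. \<Prod>n\<in>N. g n)" for K and g :: "nat \<Rightarrow> 'b::comm_ring_1"
    using prod_add[of "{..<K}" g "\<lambda>_. 1"] by (simp add: add.commute)
  have "(\<lambda>N. norm (\<Prod>n\<in>N. d n)) summable_on Collect finite"
  proof (rule nonneg_bdd_above_summable_on)
    show "bdd_above (sum (\<lambda>N. norm (\<Prod>n\<in>N. d n)) ` {F. F \<subseteq> Collect finite \<and> finite F})"
    proof (rule bdd_aboveI2)
      fix F :: "nat set set" assume "F \<in> {F. F \<subseteq> Collect finite \<and> finite F}"
      hence "finite (\<Union>F)" by auto
      then obtain K where K: "\<Union>F \<subseteq> {..<K}"
        using finite_nat_iff_bounded by blast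
      have "(\<Sum>N\<in>F. norm (\<Prod>n\<in>N. d n)) \<le> (\<Sum>N\<in>Pow {..<K}. norm (\<Prod>n\<in>N. d n))"
        by (rule sum_mono2) (use K in auto)
      also have "\<dots> = (\<Prod>n<K. 1 + cmod (d n))"
        by (simp add: expand prod_norm)
      also have "\<dots> \<le> exp (\<Sum>n<K. cmod (d n))"
        by (rule prod_le_exp_sum) auto
      also have "\<dots> \<le> exp (\<Sum>n. cmod (d n))"
        using sum_le_suminf[OF assms] by auto
      finally show "(\<Sum>N\<in>F. norm (\<Prod>n\<in>N. d n)) \<le> exp (\<Sum>n. cmod (d n))" .
    qed
  qed auto
  hence "(\<lambda>N. \<Prod>n\<in>N. d n) summable_on Collect finite"
    by (rule abs_summable_summable)
  then obtain s where s: "((\<lambda>N. \<Prod>n\<in>N. d n) has_sum s) (Collect finite)"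
    by (auto simp: summable_on_def)
  have "filterlim (\<lambda>K. Pow {..<K}) (finite_subsets_at_top (Collect finite)) sequentially"
    unfolding filterlim_finite_subsets_at_top
  proof (intro allI impI)
    fix X :: "nat set set" assume X: "finite X \<and> X \<subseteq> Collect finite"
    hence "finite (\<Union>X)" by auto
    then obtain K where K: "\<Union>X \<subseteq> {..<K}"
      using finite_nat_iff_bounded by blast
    show "\<forall>\<^sub>F K in sequentially. finite (Pow {..<K}) \<and> X \<subseteq> Pow {..<K} \<and> Pow {..<K} \<subseteq> Collect finite"
      using eventually_ge_at_top[of K]
    proof eventually_elim
      case (elim L)
      hence "{..<K} \<subseteq> {..<L}" by simp
      with K have "\<Union>X \<subseteq> {..<L}" by (rule subset_trans)
      hence "X \<subseteq> Pow {..<L}" by (meson PowI Union_upper subsetI subset_trans)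
      moreover have "Pow {..<L} \<subseteq> Collect finite"
        by (rule subsetI) (simp only: Pow_iff mem_Collect_eq finite_subset[OF _ finite_lessThan])
      ultimately show ?case by simp
    qed
  qed
  from filterlim_compose[OF s[unfolded has_sum_def] this]
  have "(\<lambda>K. \<Prod>n<K. 1 + d n) \<longlonglongrightarrow> s"
    by (simp add: expand)
  with prodinf_1_plus_LIMSEQ[OF assms] have "s = (\<Prod>n. 1 + d n)"
    by (rule LIMSEQ_unique[symmetric])
  with s show ?thesis by simp
qed

text \<open>
  In the Leibniz formula a permutation that moves some basis vector contributes an off-diagonal
  entry, which is zero; only the identity survives.
\<close>

lemma principal_minor_diag_op:
  assumes "bounded (range d)" "finite N"
  shows "principal_minor (diag_op d) (ell2_unit ` N) = (\<Prod>n\<in>N. d n)"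
proof -
  let ?F = "ell2_unit ` N"
  let ?t = "\<lambda>p. of_int (sign p) * (\<Prod>e\<in>?F. cinner (diag_op d (p e)) e)"
  have "principal_minor (diag_op d) ?F = (\<Sum>p\<in>{id}. ?t p)"
    unfolding principal_minor_def
  proof (rule sum.mono_neutral_right)
    show "finite {p. p permutes ?F}" using assms by (simp add: finite_permutations)
    show "{id} \<subseteq> {p. p permutes ?F}" by (simp add: permutes_id)
    show "\<forall>p\<in>{p. p permutes ?F} - {id}. ?t p = 0"
    proof
      fix p assume p: "p \<in> {p. p permutes ?F} - {id}"
      then obtain e where "p e \<noteq> e" by fastforce
      moreover from this p have e: "e \<in> ?F" "p e \<in> ?F"
        by (auto simp: permutes_def permutes_in_image)
      ultimately obtain m n where "e = ell2_unit n" "p e = ell2_unit m" "m \<noteq> n" by auto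
      hence "cinner (diag_op d (p e)) e = 0"
        by (simp add: cinner_ell2_unit Rep_diag_op[OF assms(1)] Rep_ell2_unit)
      thus "?t p = 0"
        using e(1) assms(2) by (simp only: mult_eq_0_iff prod_zero_iff finite_imageI) blast
    qed
  qed
  also have "\<dots> = (\<Prod>e\<in>?F. cinner (diag_op d e) e)"
    by (simp add: sign_id)
  also have "\<dots> = (\<Prod>n\<in>N. d n)"
    by (subst prod.reindex)
       (auto intro: inj_on_subset[OF inj_ell2_unit]
             simp: cinner_ell2_unit Rep_diag_op[OF assms(1)] Rep_ell2_unit)
  finally show ?thesis .
qed

lemma has_fredholm_det_diag_op:
  assumes "summable (\<lambda>n. cmod (d n))"
  shows "has_fredholm_det (diag_op d) (\<Prod>n. 1 + d n)"
proof -
  have b: "bounded (range d)" using assms by (rule bounded_range_summable)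
  have inj: "inj_on ((`) ell2_unit) (Collect finite)"
    by (rule inj_onI) (simp add: inj_image_eq_iff[OF inj_ell2_unit])
  have "{F. finite F \<and> F \<subseteq> range ell2_unit} = (`) ell2_unit ` Collect finite"
    by (auto simp: image_iff) (metis finite_subset_image subset_UNIV)
  moreover have "(principal_minor (diag_op d) has_sum (\<Prod>n. 1 + d n)) ((`) ell2_unit ` Collect finite)"
    unfolding has_sum_reindex[OF inj]
    using has_sum_prod_finite_subsets[OF assms]
    by (rule has_sum_cong[THEN iffD1, rotated]) (simp add: principal_minor_diag_op[OF b])
  ultimately show ?thesis
    unfolding has_fredholm_det_def using orthonormal_basis_ell2_unit by auto
qed

text \<open>
  The functions that arise as determinants below: the index \<open>n\<close> contributes a simple
  oscillation of period \<open>t\<close> in the direction given by the sign \<open>s n\<close>. Both signs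
  are needed in one product, since the two halves of the theta function oscillate in opposite
  directions.
\<close>

definition periodic_product :: "real \<Rightarrow> (complex \<Rightarrow> complex) \<Rightarrow> bool"
  where "periodic_product t f \<longleftrightarrow>
    (\<exists>(e :: nat \<Rightarrow> complex) s. summable (\<lambda>n. cmod (e n)) \<and> (\<forall>n. s n \<in> {1, -1}) \<and>
       (\<forall>x. f x = (\<Prod>n. 1 + e n * exp (s n * (2 * of_real pi * \<i> / of_real t) * x))))"

lemma summable_periodic_product:
  fixes e s :: "nat \<Rightarrow> complex"
  assumes "summable (\<lambda>n. cmod (e n))" "\<And>n. s n \<in> {1, -1}"
  shows "summable (\<lambda>n. cmod (e n * exp (s n * c * x)))"
proof (rule summable_comparison_test')
  show "summable (\<lambda>n. cmod (e n) * exp (cmod (c * x)))"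
    using assms(1) by (rule summable_mult2)
  show "norm (cmod (e n * exp (s n * c * x))) \<le> cmod (e n) * exp (cmod (c * x))" for n
    using norm_exp[of "s n * c * x"] assms(2)[of n]
    by (auto simp: norm_mult intro!: mult_left_mono)
qed

text \<open>
  The system is $A = \mathrm{diag}(s_n \pi i/t)$, $E = \mathrm{diag}(e_n)$, with $B = AE + EA$ and
  \<open>C\<close> the identity. All operators are diagonal, so the determinant is the product of the
  diagonal entries of $I + e^{xA}Ee^{xA}$. Only the two frequencies $\pm \pi/t$ occur, so
  \<open>A\<close> is bounded.
\<close>

lemma uniformly_periodic_tau_periodic_product:
  assumes "periodic_product t f" "t \<noteq> 0"
  shows "uniformly_periodic_tau TYPE(ell2) TYPE(ell2) f"
proof -
  obtain e s where e: "summable (\<lambda>n. cmod (e n))" and s: "\<And>n. s n \<in> {1, -1 :: complex}"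
    and f: "\<And>x. f x = (\<Prod>n. 1 + e n * exp (s n * (2 * of_real pi * \<i> / of_real t) * x))"
    using assms(1) unfolding periodic_product_def by blast
  \<comment> \<open>Half the frequency of the product: the exponential of A stands on both sides of E.\<close>
  define a where "a = (\<lambda>n. s n * (of_real pi * \<i> / of_real t))"
  have a: "bounded (range a)"
    unfolding bounded_iff
  proof (intro exI ballI)
    fix y assume "y \<in> range a"
    then obtain n where "y = a n" by auto
    thus "norm y \<le> norm (of_real pi * \<i> / of_real t :: complex)"
      using s[of n] by (auto simp: a_def)
  qed
  have be: "bounded (range e)" using e by (rule bounded_range_summable)
  let ?A = "diag_op a" and ?E = "diag_op e"
  have ax: "bounded (range (\<lambda>n. exp (x * a n)))" for x
  proof -
    have "cmod (exp (x * a n)) \<le> exp (cmod (x * (of_real pi * \<i> / of_real t)))" for n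
      using norm_exp[of "x * a n"] s[of n] by (auto simp: a_def)
    thus ?thesis by (auto simp: bounded_iff)
  qed
  have "periodic_group ?A"
    unfolding periodic_group_def
  proof (intro exI[of _ "2 * \<bar>t\<bar>"] conjI allI)
    \<comment> \<open>The halved frequency doubles the period.\<close>
    show "0 < 2 * \<bar>t\<bar>" using assms(2) by simp
    fix x :: real
    have "exp (of_real (x + 2 * \<bar>t\<bar>) * a n) = exp (of_real x * a n)" for n
    proof -
      have "of_real (2 * \<bar>t\<bar>) * a n = 2 * of_real pi * \<i> \<or> of_real (2 * \<bar>t\<bar>) * a n = - (2 * of_real pi * \<i>)"
        using assms(2) s[of n] by (auto simp: a_def field_simps abs_if)
      hence "exp (of_real (2 * \<bar>t\<bar>) * a n) = 1"
        by (elim disjE) (simp_all only: exp_minus exp_two_pi_i inverse_1)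
      thus ?thesis by (simp only: of_real_add distrib_right exp_add mult_1_right)
    qed
    thus "op_exp ?A (of_real (x + 2 * \<bar>t\<bar>)) = op_exp ?A (of_real x)"
      unfolding op_exp_diag_op[OF a] by presburger
  qed
  moreover have "?A (?E v) + ?E (?A v) = (diag_op (\<lambda>n. 2 * (a n * e n))) v" for v
  proof -
    have "bounded (range (\<lambda>n. 2 * (a n * e n)))"
      using bounded_range_mult[OF bounded_range_mult[OF a be], of "\<lambda>_. 2"]
      by (simp add: image_constant_conv mult.commute)
    thus ?thesis
      by (auto intro!: ell2_eqI simp: Rep_diag_op a be Rep_ell2_add)
  qed
  moreover have "bounded_clinear (diag_op (\<lambda>n. 2 * (a n * e n)))"
    using bounded_range_mult[OF bounded_range_mult[OF a be], of "\<lambda>_. 2"]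
    by (intro bounded_clinear_diag_op) (simp add: image_constant_conv mult.commute)
  moreover have "has_fredholm_det (op_exp ?A x \<circ> ?E \<circ> op_exp ?A x) (f x)" for x
  proof -
    have "op_exp ?A x \<circ> ?E \<circ> op_exp ?A x
        = diag_op (\<lambda>n. e n * exp (s n * (2 * of_real pi * \<i> / of_real t) * x))"
    proof -
      have eq: "exp (x * a n) * e n * exp (x * a n) = e n * exp (s n * (2 * of_real pi * \<i> / of_real t) * x)" for n
      proof -
        have eq: "exp (x * a n) * e n * exp (x * a n) = e n * exp (x * a n + x * a n)"
          by (simp only: exp_add mult_ac)
        also have "x * a n + x * a n = s n * (2 * of_real pi * \<i> / of_real t) * x"
          by (simp add: a_def)
        finally show ?thesis .
      qed
      thus ?thesis
        unfolding op_exp_diag_op[OF a] by (simp only: diag_op_comp ax be bounded_range_mult eq)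
    qed
    thus ?thesis
      unfolding f using has_fredholm_det_diag_op[OF summable_periodic_product[of e s, OF e s]]
      by (simp only:)
  qed
  ultimately show ?thesis
    unfolding uniformly_periodic_tau_def
    using bounded_clinear_diag_op[OF a] bounded_clinear_id trace_class_diag_op[OF e] by blast
qed

lemma periodic_product_one: "periodic_product t (\<lambda>_. 1)"
  unfolding periodic_product_def
  by (rule exI[of _ "\<lambda>_. 0"], rule exI[of _ "\<lambda>_. 1"]) simp

text \<open>
  The direct sum of the two diagonal systems, realised on the same sequence space by interleaving:
  even indices carry the first system and odd indices the second.
\<close>

lemma periodic_product_mult:
  assumes "periodic_product t f" "periodic_product t g"
  shows "periodic_product t (\<lambda>x. f x * g x)"
proof -
  define c where "c = 2 * of_real pi * \<i> / complex_of_real t"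
  obtain e s where e: "summable (\<lambda>n. cmod (e n))" and s: "\<And>n. s n \<in> {1, -1 :: complex}"
    and f: "\<And>x. f x = (\<Prod>n. 1 + e n * exp (s n * c * x))"
    using assms(1) unfolding periodic_product_def c_def[symmetric] by blast
  obtain e' s' where e': "summable (\<lambda>n. cmod (e' n))" and s': "\<And>n. s' n \<in> {1, -1 :: complex}"
    and g: "\<And>x. g x = (\<Prod>n. 1 + e' n * exp (s' n * c * x))"
    using assms(2) unfolding periodic_product_def c_def[symmetric] by blast
  define E where "E = (\<lambda>n. if even n then e (n div 2) else e' (n div 2))"
  define S where "S = (\<lambda>n. if even n then s (n div 2) else s' (n div 2))"
  have split_sum: "(\<Sum>n<2*N. h n) = (\<Sum>n<N. h (2*n)) + (\<Sum>n<N. h (2*n+1))" for N and h :: "nat \<Rightarrow> real"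
    by (induction N) (auto simp: algebra_simps)
  have split_prod: "(\<Prod>n<2*N. h n) = (\<Prod>n<N. h (2*n)) * (\<Prod>n<N. h (2*n+1))" for N and h :: "nat \<Rightarrow> complex"
    by (induction N) (auto simp: algebra_simps)
  have E: "summable (\<lambda>n. cmod (E n))"
  proof (rule summableI_nonneg_bounded)
    fix N
    have "(\<Sum>n<N. cmod (E n)) \<le> (\<Sum>n<2*N. cmod (E n))"
      by (rule sum_mono2) auto
    also have "\<dots> = (\<Sum>n<N. cmod (e n)) + (\<Sum>n<N. cmod (e' n))"
      by (simp add: split_sum E_def)
    also have "\<dots> \<le> (\<Sum>n. cmod (e n)) + (\<Sum>n. cmod (e' n))"
      by (intro add_mono sum_le_suminf e e') auto
    finally show "(\<Sum>n<N. cmod (E n)) \<le> (\<Sum>n. cmod (e n)) + (\<Sum>n. cmod (e' n))" .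
  qed auto
  have S: "S n \<in> {1, -1}" for n using s s' by (simp add: S_def)
  have "f x * g x = (\<Prod>n. 1 + E n * exp (S n * c * x))" for x
  proof (rule LIMSEQ_unique)
    show "(\<lambda>N. \<Prod>n<2*N. 1 + E n * exp (S n * c * x)) \<longlonglongrightarrow> (\<Prod>n. 1 + E n * exp (S n * c * x))"
      using LIMSEQ_subseq_LIMSEQ[OF prodinf_1_plus_LIMSEQ[OF summable_periodic_product[of E S, OF E S]], of "\<lambda>N. 2 * N"]
      by (simp add: strict_mono_def o_def)
    show "(\<lambda>N. \<Prod>n<2*N. 1 + E n * exp (S n * c * x)) \<longlonglongrightarrow> f x * g x"
      unfolding split_prod f g
      using tendsto_mult[OF prodinf_1_plus_LIMSEQ[OF summable_periodic_product[of e s, OF e s]]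
               prodinf_1_plus_LIMSEQ[OF summable_periodic_product[of e' s', OF e' s']]]
      by (simp add: E_def S_def)
  qed
  thus ?thesis
    unfolding periodic_product_def c_def[symmetric] using E S by blast
qed

lemma periodic_product_power:
  assumes "periodic_product t f"
  shows "periodic_product t (\<lambda>x. f x ^ k)"
proof (induction k)
  case 0
  show ?case by (simp add: periodic_product_one)
next
  case (Suc k)
  show ?case using periodic_product_mult[OF assms Suc] by simp
qed

lemma periodic_product_prod:
  assumes "\<And>a. a \<in> Z \<Longrightarrow> periodic_product t (f a)"
  shows "periodic_product t (\<lambda>x. \<Prod>a\<in>Z. f a x)"
  using assms
proof (induction Z rule: infinite_finite_induct)
  case (insert a Z)
  have "periodic_product t (\<lambda>x. f a x * (\<Prod>a\<in>Z. f a x))"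
    using insert by (intro periodic_product_mult) auto
  thus ?case using insert by simp
qed (simp_all add: periodic_product_one)

section \<open>Meromorphic functions up to a sparse set\<close>

text \<open>
  A non-constant affine map is a homeomorphism, so it preserves identities off a sparse set. This
  carries functional equations along translations and rescalings of the variable.
\<close>

lemma cosparse_compose_affine:
  fixes P :: "complex \<Rightarrow> bool"
  assumes "\<forall>\<^sub>\<approx>z. P z" "c \<noteq> 0"
  shows "\<forall>\<^sub>\<approx>z. P (c * z + p)"
  unfolding eventually_cosparse_open_eq[OF open_UNIV]
proof
  fix z :: complex
  have "filterlim (\<lambda>z. c * z + p) (at (c * z + p)) (at z)"
    using assms(2)
    by (auto simp: filterlim_at eventually_at_filter intro!: tendsto_eq_intros)
  thus "\<forall>\<^sub>F z in at z. P (c * z + p)"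
    using assms(1) unfolding eventually_cosparse_open_eq[OF open_UNIV]
    by (auto simp: filterlim_iff)
qed

lemma cosparse_shift:
  fixes P :: "complex \<Rightarrow> bool"
  shows "\<forall>\<^sub>\<approx>z. P z \<Longrightarrow> \<forall>\<^sub>\<approx>z. P (z + p)"
  using cosparse_compose_affine[of P 1 p] by simp

text \<open>
  The exceptional set is closed, so an identity that holds off it holds near each of the other
  points; in particular it may be differentiated.
\<close>

lemma cosparse_eventually_nhds:
  fixes P :: "complex \<Rightarrow> bool"
  assumes "\<forall>\<^sub>\<approx>z. P z"
  shows "\<forall>\<^sub>\<approx>z. \<forall>\<^sub>F w in nhds z. P w"
proof -
  from assms have "closed {z. \<not> P z}"
    unfolding eventually_cosparse by (rule sparse_in_UNIV_imp_closed)
  hence op: "open {z. P z}"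
    by (simp add: closed_def Compl_eq)
  show ?thesis
    using assms by eventually_elim (use op eventually_nhds in blast)
qed

lemma cosparse_deriv_cong:
  fixes f g :: "complex \<Rightarrow> complex"
  assumes "\<forall>\<^sub>\<approx>z. f z = g z"
  shows "\<forall>\<^sub>\<approx>z. deriv f z = deriv g z"
  using cosparse_eventually_nhds[OF assms]
  by eventually_elim (auto intro: deriv_cong_ev)

lemma meromorphic_on_compose_affine:
  assumes "f meromorphic_on UNIV"
  shows "(\<lambda>z. f (c * z + p)) meromorphic_on UNIV"
  by (rule meromorphic_on_compose[OF assms]) (auto intro!: analytic_intros)

lemma meromorphic_on_shift:
  assumes "f meromorphic_on UNIV"
  shows "(\<lambda>z. f (z + p)) meromorphic_on UNIV"
  using meromorphic_on_compose_affine[OF assms, of 1 p] by simp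

lemma deriv_shift_arg:
  fixes f :: "complex \<Rightarrow> complex"
  shows "deriv (\<lambda>z. f (z + p)) z = deriv f (z + p)"
  unfolding deriv_def using DERIV_shift[of f _ z p] by simp

lemma cosparse_analytic:
  fixes f :: "complex \<Rightarrow> complex"
  assumes "f meromorphic_on UNIV"
  shows "\<forall>\<^sub>\<approx>z. f analytic_on {z}"
  using assms by (rule meromorphic_on_imp_analytic_cosparse)

lemma analytic_at_DERIV:
  "f analytic_on {z} \<Longrightarrow> (f has_field_derivative deriv f z) (at z)"
  by (simp add: analytic_on_imp_differentiable_at field_differentiable_derivI)

text \<open>
  The plane without a closed sparse set is still open and connected.
\<close>

lemma meromorphic_deriv_0_imp_constant:
  assumes "f meromorphic_on UNIV" "\<forall>\<^sub>\<approx>z. deriv f z = 0"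
  shows "\<exists>c. \<forall>\<^sub>\<approx>z. f z = c"
proof -
  define S where "S = {z. \<not> (f analytic_on {z} \<and> deriv f z = 0)}"
  have "\<forall>\<^sub>\<approx>z. f analytic_on {z} \<and> deriv f z = 0"
    using cosparse_analytic[OF assms(1)] assms(2) by (rule eventually_conj)
  hence S: "S sparse_in UNIV"
    unfolding eventually_cosparse S_def .
  have "f constant_on (UNIV - S)"
  proof (rule has_field_derivative_0_imp_constant_on)
    fix z assume "z \<in> UNIV - S"
    thus "(f has_field_derivative 0) (at z)"
      using analytic_at_DERIV[of f z] by (auto simp: S_def)
  next
    show "open (UNIV - S)" using S by (intro open_diff_sparse_pts) auto
    show "connected (UNIV - S)" using S by (intro sparse_imp_connected) auto
  qed
  then obtain c where c: "\<And>z. z \<notin> S \<Longrightarrow> f z = c"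
    by (auto simp: constant_on_def)
  have "\<forall>\<^sub>\<approx>z. z \<notin> S" using S by (rule eventually_not_in_cosparse)
  hence "\<forall>\<^sub>\<approx>z. f z = c" by eventually_elim (use c in auto)
  thus ?thesis ..
qed

lemma meromorphic_nonzero_cosparse:
  assumes "f meromorphic_on UNIV" "\<not> (\<forall>\<^sub>\<approx>z. f z = 0)"
  shows "\<forall>\<^sub>\<approx>z. f z \<noteq> 0"
  using meromorphic_imp_constant_or_avoid[OF assms(1), of 0] assms(2) by auto


text \<open>
  By continuity an identity between entire functions has no exceptional points.
\<close>

lemma cosparse_eq_entire:
  fixes f g :: "complex \<Rightarrow> complex"
  assumes "f holomorphic_on UNIV" "g holomorphic_on UNIV" "\<forall>\<^sub>\<approx>z. f z = g z"
  shows "f z = g z"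
proof -
  have ev: "\<forall>\<^sub>F w in at z. f w = g w"
    using assms(3) by (rule eventually_cosparse_imp_eventually_at) simp
  have "f \<midarrow>z\<rightarrow> f z" "g \<midarrow>z\<rightarrow> g z"
    using assms(1,2) by (auto simp: isCont_def[symmetric] dest!: holomorphic_on_imp_continuous_on
        simp: continuous_on_eq_continuous_at)
  from this(1) have "g \<midarrow>z\<rightarrow> f z" using tendsto_cong[OF ev] by blast
  with \<open>g \<midarrow>z\<rightarrow> g z\<close> show ?thesis using LIM_unique by blast
qed


section \<open>Floquet solutions of Hill's equation\<close>

lemma deriv_lincomb:
  fixes f g :: "complex \<Rightarrow> complex"
  assumes "f analytic_on {z}" "g analytic_on {z}"
  shows "deriv (\<lambda>z. a * f z + b * g z) z = a * deriv f z + b * deriv g z"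
proof (rule DERIV_imp_deriv)
  show "((\<lambda>z. a * f z + b * g z) has_field_derivative a * deriv f z + b * deriv g z) (at z)"
    by (intro DERIV_add DERIV_cmult analytic_at_DERIV assms)
qed

lemma hill_solution_lincomb:
  assumes "hill_solution u \<mu> f" "hill_solution u \<mu> g"
  shows "hill_solution u \<mu> (\<lambda>z. a * f z + b * g z)"
proof -
  let ?h = "\<lambda>z. a * f z + b * g z"
  have m: "f meromorphic_on UNIV" "g meromorphic_on UNIV"
    using assms by (auto simp: hill_solution_def)
  have d1: "\<forall>\<^sub>\<approx>z. deriv ?h z = a * deriv f z + b * deriv g z"
    using cosparse_analytic[OF m(1)] cosparse_analytic[OF m(2)]
    by eventually_elim (rule deriv_lincomb)
  have d2: "\<forall>\<^sub>\<approx>z. deriv (\<lambda>z. a * deriv f z + b * deriv g z) z = a * deriv (deriv f) z + b * deriv (deriv g) z"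
    using cosparse_analytic[OF meromorphic_on_deriv[OF m(1)]] cosparse_analytic[OF meromorphic_on_deriv[OF m(2)]]
    by eventually_elim (rule deriv_lincomb)
  have "\<forall>\<^sub>\<approx>z. - deriv (deriv f) z + u z * f z = \<mu> * f z"
       "\<forall>\<^sub>\<approx>z. - deriv (deriv g) z + u z * g z = \<mu> * g z"
    using assms by (auto simp: hill_solution_def)
  with cosparse_deriv_cong[OF d1] d2
  have "\<forall>\<^sub>\<approx>z. - deriv (deriv ?h) z + u z * ?h z = \<mu> * ?h z"
  proof eventually_elim
    case (elim z)
    have "- deriv (deriv ?h) z + u z * ?h z
        = a * (- deriv (deriv f) z + u z * f z) + b * (- deriv (deriv g) z + u z * g z)"
      using elim(1,2) by (simp add: algebra_simps)
    thus ?case unfolding elim(3,4) by (simp add: algebra_simps)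
  qed
  moreover have "?h meromorphic_on UNIV" by (intro meromorphic_intros m)
  ultimately show ?thesis by (simp add: hill_solution_def)
qed

lemma hill_solution_shift:
  assumes "\<forall>\<^sub>\<approx>z. u (z + p) = u z" "hill_solution u \<mu> f"
  shows "hill_solution u \<mu> (\<lambda>z. f (z + p))"
proof -
  have "deriv (\<lambda>z. f (z + p)) = (\<lambda>z. deriv f (z + p))"
    by (rule ext) (rule deriv_shift_arg)
  hence d: "deriv (deriv (\<lambda>z. f (z + p))) z = deriv (deriv f) (z + p)" for z
    by (simp add: deriv_shift_arg)
  have "\<forall>\<^sub>\<approx>z. - deriv (deriv f) (z + p) + u (z + p) * f (z + p) = \<mu> * f (z + p)"
    using assms(2) unfolding hill_solution_def by (intro cosparse_shift) blast
  with assms(1) have "\<forall>\<^sub>\<approx>z. - deriv (deriv (\<lambda>z. f (z + p))) z + u z * f (z + p) = \<mu> * f (z + p)"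
    unfolding d by eventually_elim simp
  thus ?thesis
    using assms(2) meromorphic_on_shift[of f p] by (auto simp: hill_solution_def)
qed

definition wronskian :: "(complex \<Rightarrow> complex) \<Rightarrow> (complex \<Rightarrow> complex) \<Rightarrow> complex \<Rightarrow> complex"
  where "wronskian f g z = f z * deriv g z - g z * deriv f z"

text \<open>
  The equation has no first-order term, so $(fg' - gf')' = fg'' - gf'' = 0$.
\<close>

lemma wronskian_hill_constant:
  assumes "hill_solution u \<mu> f" "hill_solution u \<mu> g"
  shows "\<exists>k. \<forall>\<^sub>\<approx>z. wronskian f g z = k"
proof (rule meromorphic_deriv_0_imp_constant)
  have m: "f meromorphic_on UNIV" "g meromorphic_on UNIV"
    using assms by (auto simp: hill_solution_def)
  have W: "wronskian f g = (\<lambda>z. f z * deriv g z - g z * deriv f z)"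
    by (simp add: fun_eq_iff wronskian_def)
  show "wronskian f g meromorphic_on UNIV"
    unfolding W by (intro meromorphic_intros m)
  have "\<forall>\<^sub>\<approx>z. - deriv (deriv f) z + u z * f z = \<mu> * f z"
       "\<forall>\<^sub>\<approx>z. - deriv (deriv g) z + u z * g z = \<mu> * g z"
    using assms by (auto simp: hill_solution_def)
  with cosparse_analytic[OF m(1)] cosparse_analytic[OF m(2)]
    cosparse_analytic[OF meromorphic_on_deriv[OF m(1)]] cosparse_analytic[OF meromorphic_on_deriv[OF m(2)]]
  show "\<forall>\<^sub>\<approx>z. deriv (wronskian f g) z = 0"
  proof eventually_elim
    case (elim z)
    have "(wronskian f g has_field_derivative
            (deriv f z * deriv g z + deriv (deriv g) z * f z) -
            (deriv g z * deriv f z + deriv (deriv f) z * g z)) (at z)"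
      unfolding W by (intro DERIV_diff DERIV_mult analytic_at_DERIV elim)
    hence "(wronskian f g has_field_derivative
            f z * deriv (deriv g) z - g z * deriv (deriv f) z) (at z)"
      by (simp add: algebra_simps)
    moreover have "f z * deriv (deriv g) z - g z * deriv (deriv f) z = 0"
    proof -
      have e: "deriv (deriv f) z = u z * f z - \<mu> * f z" "deriv (deriv g) z = u z * g z - \<mu> * g z"
        using elim(5,6) by (auto simp: algebra_simps add_eq_0_iff)
      show ?thesis unfolding e by (simp add: algebra_simps)
    qed
    ultimately show ?case by (simp add: DERIV_imp_deriv)
  qed
qed

text \<open>
  The derivative of \<open>g / f\<close> is the Wronskian divided by the square of \<open>f\<close>; if the
  Wronskian vanished, \<open>g\<close> would be a multiple of \<open>f\<close>.
\<close>

lemma wronskian_fundamental_nonzero: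
  assumes "hill_fundamental_system u \<mu> f g"
  shows "\<exists>k. k \<noteq> 0 \<and> (\<forall>\<^sub>\<approx>z. wronskian f g z = k)"
proof -
  have sol: "hill_solution u \<mu> f" "hill_solution u \<mu> g"
    and indep: "\<And>a b. \<forall>\<^sub>\<approx>z. a * f z + b * g z = 0 \<Longrightarrow> a = 0 \<and> b = 0"
    using assms unfolding hill_fundamental_system_def by blast+
  have m: "f meromorphic_on UNIV" "g meromorphic_on UNIV"
    using sol by (auto simp: hill_solution_def)
  obtain k where k: "\<forall>\<^sub>\<approx>z. wronskian f g z = k"
    using wronskian_hill_constant[OF sol] by blast
  have "k \<noteq> 0"
  proof
    assume "k = 0"
    have "\<not> (\<forall>\<^sub>\<approx>z. f z = 0)"
      using indep[of 1 0] by auto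
    with m(1) have nz: "\<forall>\<^sub>\<approx>z. f z \<noteq> 0" by (rule meromorphic_nonzero_cosparse)
    have "\<exists>c. \<forall>\<^sub>\<approx>z. g z / f z = c"
    proof (rule meromorphic_deriv_0_imp_constant)
      show "(\<lambda>z. g z / f z) meromorphic_on UNIV" by (intro meromorphic_intros m)
      from nz cosparse_analytic[OF m(1)] cosparse_analytic[OF m(2)] k
      show "\<forall>\<^sub>\<approx>z. deriv (\<lambda>z. g z / f z) z = 0"
      proof eventually_elim
        case (elim z)
        have "((\<lambda>z. g z / f z) has_field_derivative wronskian f g z / (f z * f z)) (at z)"
          by (rule derivative_eq_intros analytic_at_DERIV elim refl)+
             (simp add: wronskian_def mult_ac)
        thus ?case using elim(4) \<open>k = 0\<close> by (simp add: DERIV_imp_deriv)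
      qed
    qed
    then obtain c where "\<forall>\<^sub>\<approx>z. g z / f z = c" by blast
    with nz have "\<forall>\<^sub>\<approx>z. c * f z + (-1) * g z = 0"
      by eventually_elim (auto simp: field_simps)
    from indep[OF this] show False by simp
  qed
  with k show ?thesis by blast
qed

text \<open>
  Cramer's rule: the identity $h\,W(f,g) = W(h,g)\,f + W(f,h)\,g$ holds for any three functions,
  and for solutions all three Wronskians are constant.
\<close>

lemma hill_solution_in_span:
  assumes "hill_fundamental_system u \<mu> f g" "hill_solution u \<mu> h"
  shows "\<exists>a b. \<forall>\<^sub>\<approx>z. h z = a * f z + b * g z"
proof -
  have sol: "hill_solution u \<mu> f" "hill_solution u \<mu> g"
    using assms(1) unfolding hill_fundamental_system_def by blast+
  obtain k where k: "k \<noteq> 0" "\<forall>\<^sub>\<approx>z. wronskian f g z = k"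
    using wronskian_fundamental_nonzero[OF assms(1)] by blast
  obtain l where l: "\<forall>\<^sub>\<approx>z. wronskian h g z = l"
    using wronskian_hill_constant[OF assms(2) sol(2)] by blast
  obtain m where m: "\<forall>\<^sub>\<approx>z. wronskian f h z = m"
    using wronskian_hill_constant[OF sol(1) assms(2)] by blast
  have "\<forall>\<^sub>\<approx>z. h z = l / k * f z + m / k * g z"
    using k(2) l m
  proof eventually_elim
    case (elim z)
    have "h z * wronskian f g z = wronskian h g z * f z + wronskian f h z * g z"
      by (simp add: wronskian_def algebra_simps)
    thus ?case using k(1) unfolding elim by (simp add: field_simps)
  qed
  thus ?thesis by blast
qed

lemma complex_quadratic_root:
  fixes a b c :: complex
  assumes "a \<noteq> 0"
  shows "\<exists>x. a * x\<^sup>2 + b * x + c = 0"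
proof (intro exI)
  define x where "x = (csqrt (b\<^sup>2 - 4 * a * c) - b) / (2 * a)"
  have "2 * a * x + b = csqrt (b\<^sup>2 - 4 * a * c)"
    using assms by (simp add: x_def)
  hence "(2 * a * x + b)\<^sup>2 = b\<^sup>2 - 4 * a * c" by simp
  hence "4 * a * (a * x\<^sup>2 + b * x + c) = 0"
    by (simp add: power2_eq_square algebra_simps)
  thus "a * x\<^sup>2 + b * x + c = 0"
    using assms by simp
qed

text \<open>
  Translation by a period acts on the span of \<open>f\<close> and \<open>g\<close> by a complex two-by-two
  matrix, which has an eigenvector.
\<close>

lemma hill_floquet_solution:
  assumes fs: "hill_fundamental_system u \<mu> f g" and per: "\<forall>\<^sub>\<approx>z. u (z + p) = u z"
  shows "\<exists>x y \<rho>. (x \<noteq> 0 \<or> y \<noteq> 0) \<and>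
           (\<forall>\<^sub>\<approx>z. x * f (z + p) + y * g (z + p) = \<rho> * (x * f z + y * g z))"
proof -
  have sol: "hill_solution u \<mu> f" "hill_solution u \<mu> g"
    using fs unfolding hill_fundamental_system_def by blast+
  obtain a b where ab: "\<forall>\<^sub>\<approx>z. f (z + p) = a * f z + b * g z"
    using hill_solution_in_span[OF fs hill_solution_shift[OF per sol(1)]] by blast
  obtain c d where cd: "\<forall>\<^sub>\<approx>z. g (z + p) = c * f z + d * g z"
    using hill_solution_in_span[OF fs hill_solution_shift[OF per sol(2)]] by blast
  show ?thesis
  \<comment> \<open>The translation has matrix rows (a, b) and (c, d); if b = 0, then f is an eigenvector, and otherwise an eigenvector x f + g exists with x a root of a quadratic.\<close>
  proof (cases "b = 0")
    case True
    have "\<forall>\<^sub>\<approx>z. 1 * f (z + p) + 0 * g (z + p) = a * (1 * f z + 0 * g z)"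
      using ab True by simp
    moreover have "(1::complex) \<noteq> 0 \<or> (0::complex) \<noteq> 0" by simp
    ultimately show ?thesis by (intro exI conjI)
  next
    case False
    then obtain x where x: "b * x\<^sup>2 + (d - a) * x + (- c) = 0"
      using complex_quadratic_root by blast
    have "\<forall>\<^sub>\<approx>z. x * f (z + p) + 1 * g (z + p) = (x * b + d) * (x * f z + 1 * g z)"
      using ab cd
    proof eventually_elim
      case (elim z)
      have "x * a + c = (x * b + d) * x"
        using x by (simp add: algebra_simps power2_eq_square)
      hence "(x * a + c) * f z + (x * b + d) * g z = (x * b + d) * (x * f z + 1 * g z)"
        by (simp add: algebra_simps)
      thus ?case unfolding elim by (simp add: algebra_simps)
    qed
    moreover have "x \<noteq> 0 \<or> (1::complex) \<noteq> 0" by simp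
    ultimately show ?thesis by (intro exI conjI)
  qed
qed

text \<open>
  Let \<open>\<phi>\<close> be an eigenvector of the translation by \<open>p\<close> with eigenvalue
  \<open>\<rho>\<close>. If it is not an eigenvector of the translation by \<open>q\<close>, then
  \<open>\<phi>\<close> and its translate by \<open>q\<close> form a fundamental system; the two translations
  commute, so the translation by \<open>p\<close> is multiplication by \<open>\<rho>\<close> on all solutions, and
  any eigenvector of the translation by \<open>q\<close> will do.
\<close>

lemma hill_common_floquet_solution:
  assumes fs: "hill_fundamental_system u \<mu> f g"
    and per: "\<forall>\<^sub>\<approx>z. u (z + p) = u z" "\<forall>\<^sub>\<approx>z. u (z + q) = u z"
  shows "\<exists>\<psi> \<rho> \<sigma>. \<not> (\<forall>\<^sub>\<approx>z. \<psi> z = 0) \<and> hill_solution u \<mu> \<psi> \<and>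
           (\<forall>\<^sub>\<approx>z. \<psi> (z + p) = \<rho> * \<psi> z) \<and> (\<forall>\<^sub>\<approx>z. \<psi> (z + q) = \<sigma> * \<psi> z)"
proof -
  have sol: "hill_solution u \<mu> f" "hill_solution u \<mu> g"
    using fs unfolding hill_fundamental_system_def by blast+
  obtain x y \<rho> where xy: "x \<noteq> 0 \<or> y \<noteq> 0"
    and rho: "\<forall>\<^sub>\<approx>z. x * f (z + p) + y * g (z + p) = \<rho> * (x * f z + y * g z)"
    using hill_floquet_solution[OF fs per(1)] by blast
  define \<phi> where "\<phi> = (\<lambda>z. x * f z + y * g z)"
  have \<phi>: "hill_solution u \<mu> \<phi>"
    unfolding \<phi>_def by (rule hill_solution_lincomb[OF sol])
  have \<phi>0: "\<not> (\<forall>\<^sub>\<approx>z. \<phi> z = 0)"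
    using fs xy unfolding \<phi>_def hill_fundamental_system_def by blast
  have \<phi>p: "\<forall>\<^sub>\<approx>z. \<phi> (z + p) = \<rho> * \<phi> z"
    using rho by (simp add: \<phi>_def)
  show ?thesis
  proof (cases "\<exists>\<sigma>. \<forall>\<^sub>\<approx>z. \<phi> (z + q) = \<sigma> * \<phi> z")
    case True
    with \<phi> \<phi>0 \<phi>p show ?thesis by blast
  next
    case False
    have \<phi>q: "hill_solution u \<mu> (\<lambda>z. \<phi> (z + q))"
      by (rule hill_solution_shift[OF per(2) \<phi>])
    have fs': "hill_fundamental_system u \<mu> \<phi> (\<lambda>z. \<phi> (z + q))"
      unfolding hill_fundamental_system_def
    proof (intro conjI \<phi> \<phi>q allI impI)
      fix a b assume *: "\<forall>\<^sub>\<approx>z. a * \<phi> z + b * \<phi> (z + q) = 0"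
      show b: "b = 0"
      proof (rule ccontr)
        assume "b \<noteq> 0"
        from * have "\<forall>\<^sub>\<approx>z. \<phi> (z + q) = (- a / b) * \<phi> z"
        proof eventually_elim
          case (elim z)
          hence "b * \<phi> (z + q) = - (a * \<phi> z)"
            by (subst eq_neg_iff_add_eq_0) (subst add.commute)
          hence "\<phi> (z + q) = - (a * \<phi> z) / b"
            using \<open>b \<noteq> 0\<close> by (metis nonzero_mult_div_cancel_left)
          thus ?case by simp
        qed
        hence "\<exists>\<sigma>. \<forall>\<^sub>\<approx>z. \<phi> (z + q) = \<sigma> * \<phi> z" by (rule exI)
        with False show False ..
      qed
      show "a = 0"
      proof (rule ccontr)
        assume "a \<noteq> 0"
        with * b have "\<forall>\<^sub>\<approx>z. \<phi> z = 0" by simp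
        with \<phi>0 show False ..
      qed
    qed
    obtain v w \<sigma> where vw: "v \<noteq> 0 \<or> w \<noteq> 0"
      and sig: "\<forall>\<^sub>\<approx>z. v * \<phi> (z + q) + w * \<phi> (z + q + q) = \<sigma> * (v * \<phi> z + w * \<phi> (z + q))"
      using hill_floquet_solution[OF fs' per(2)] by blast
    define \<psi> where "\<psi> = (\<lambda>z. v * \<phi> z + w * \<phi> (z + q))"
    have "hill_solution u \<mu> \<psi>"
      unfolding \<psi>_def by (rule hill_solution_lincomb[OF \<phi> \<phi>q])
    moreover have "\<not> (\<forall>\<^sub>\<approx>z. \<psi> z = 0)"
      using fs' vw unfolding \<psi>_def hill_fundamental_system_def by blast
    moreover have "\<forall>\<^sub>\<approx>z. \<psi> (z + q) = \<sigma> * \<psi> z"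
      using sig by (simp add: \<psi>_def)
    moreover have "\<forall>\<^sub>\<approx>z. \<psi> (z + p) = \<rho> * \<psi> z"
      using \<phi>p cosparse_shift[OF \<phi>p, of q]
      by eventually_elim (simp add: \<psi>_def add_ac algebra_simps)
    ultimately show ?thesis by blast
  qed
qed

text \<open>
  The vectors along which a nonzero function has a multiplier form a group, and these
  multipliers are nonzero because translations are invertible.
\<close>

lemma multiplier_lattice:
  fixes \<psi> :: "complex \<Rightarrow> complex"
  assumes nz: "\<not> (\<forall>\<^sub>\<approx>z. \<psi> z = 0)"
    and p: "\<forall>\<^sub>\<approx>z. \<psi> (z + p) = \<rho> * \<psi> z" and q: "\<forall>\<^sub>\<approx>z. \<psi> (z + q) = \<sigma> * \<psi> z"
  shows "\<exists>\<kappa>. \<kappa> \<noteq> 0 \<and> (\<forall>\<^sub>\<approx>z. \<psi> (z + (of_int m * p + of_int n * q)) = \<kappa> * \<psi> z)"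
proof -
  define M where "M l \<longleftrightarrow> (\<exists>\<kappa>. \<kappa> \<noteq> 0 \<and> (\<forall>\<^sub>\<approx>z. \<psi> (z + l) = \<kappa> * \<psi> z))" for l
  have base: "M l" if l: "\<forall>\<^sub>\<approx>z. \<psi> (z + l) = \<kappa> * \<psi> z" for l \<kappa>
  proof -
    have "\<kappa> \<noteq> 0"
    proof
      assume "\<kappa> = 0"
      hence "\<forall>\<^sub>\<approx>z. \<psi> z = 0" using cosparse_shift[OF l, of "- l"] by simp
      with nz show False ..
    qed
    with l show ?thesis unfolding M_def by blast
  qed
  have add: "M (k + l)" if kl: "M k" "M l" for k l
  proof -
    obtain a b where a: "\<forall>\<^sub>\<approx>z. \<psi> (z + k) = a * \<psi> z" and b: "\<forall>\<^sub>\<approx>z. \<psi> (z + l) = b * \<psi> z"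
      using kl unfolding M_def by blast
    have "\<forall>\<^sub>\<approx>z. \<psi> (z + (k + l)) = (b * a) * \<psi> z"
      using a cosparse_shift[OF b, of k] by eventually_elim (simp add: add_ac)
    thus ?thesis by (rule base)
  qed
  have neg: "M (- l)" if l: "M l" for l
  proof -
    obtain a where a: "a \<noteq> 0" "\<forall>\<^sub>\<approx>z. \<psi> (z + l) = a * \<psi> z"
      using l unfolding M_def by blast
    have "\<forall>\<^sub>\<approx>z. \<psi> (z + - l) = (1 / a) * \<psi> z"
      using cosparse_shift[OF a(2), of "- l"] by eventually_elim (use a(1) in simp)
    thus ?thesis by (rule base)
  qed
  have M0: "M 0" by (rule base[of _ 1]) simp
  have mult: "M (of_int k * l)" if l: "M l" for l and k :: int
  proof (induction k rule: int_induct[where k = 0])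
    case base
    show ?case using M0 by simp
  next
    case (step1 i)
    show ?case using add[OF step1(2) l] by (simp add: algebra_simps)
  next
    case (step2 i)
    show ?case using add[OF step2(2) neg[OF l]] by (simp add: algebra_simps)
  qed
  have "M (of_int m * p + of_int n * q)"
    by (intro add mult base[OF p] base[OF q])
  thus ?thesis unfolding M_def .
qed

section \<open>The theta function as an infinite product\<close>

definition exp_2pi_i :: "complex \<Rightarrow> complex"
  where "exp_2pi_i z = exp (2 * of_real pi * \<i> * z)"

lemma exp_2pi_i_add: "exp_2pi_i (z + w) = exp_2pi_i z * exp_2pi_i w"
  by (simp add: exp_2pi_i_def algebra_simps exp_add)

lemma exp_2pi_i_minus: "exp_2pi_i (- z) = inverse (exp_2pi_i z)"
  by (simp add: exp_2pi_i_def exp_minus)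

lemma exp_2pi_i_nonzero [simp]: "exp_2pi_i z \<noteq> 0"
  by (simp add: exp_2pi_i_def)

lemma exp_2pi_i_0 [simp]: "exp_2pi_i 0 = 1"
  by (simp add: exp_2pi_i_def)

lemma exp_2pi_i_1 [simp]: "exp_2pi_i 1 = 1"
  by (simp add: exp_2pi_i_def exp_two_pi_i)

lemma exp_2pi_i_of_nat_mult: "exp_2pi_i (of_nat n * z) = exp_2pi_i z ^ n"
  by (simp add: exp_2pi_i_def exp_of_nat_mult[symmetric] algebra_simps)

lemma exp_2pi_i_eq_1D:
  assumes "exp_2pi_i z = 1"
  shows "\<exists>m::int. z = of_int m"
proof -
  have "exp (2 * of_real pi * \<i> * z) = exp 0" using assms by (simp add: exp_2pi_i_def)
  then obtain n :: int where "2 * of_real pi * \<i> * z = 0 + (of_int (2 * n) * of_real pi) * \<i>"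
    unfolding exp_eq by auto
  hence "(2 * of_real pi * \<i>) * z = (2 * of_real pi * \<i>) * of_int n" by simp
  hence "z = of_int n" by (subst (asm) mult_cancel_left) simp
  thus ?thesis ..
qed

lemma norm_exp_2pi_i_less_1: "Im \<tau> > 0 \<Longrightarrow> cmod (exp_2pi_i \<tau>) < 1"
  by (simp add: exp_2pi_i_def)

lemma has_field_derivative_exp_2pi_i:
  "(exp_2pi_i has_field_derivative 2 * of_real pi * \<i> * exp_2pi_i z) (at z)"
proof -
  have "((\<lambda>z. exp (2 * of_real pi * \<i> * z)) has_field_derivative
          exp (2 * of_real pi * \<i> * z) * (2 * of_real pi * \<i>)) (at z)"
    by (intro DERIV_fun_exp DERIV_cmult_Id)
  thus ?thesis by (simp add: exp_2pi_i_def[abs_def] mult_ac)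
qed

lemma exp_2pi_i_holomorphic: "exp_2pi_i holomorphic_on A"
  unfolding exp_2pi_i_def[abs_def] by (intro holomorphic_intros)

text \<open>
  The infinite \<open>q\<close>-Pochhammer symbol $(w; Q)_\infty$, written with explicit sums
  \<open>1 + d\<^sub>n\<close> to match the shape of the Fredholm determinants above.
\<close>

definition qprod :: "complex \<Rightarrow> complex \<Rightarrow> complex"
  where "qprod Q w = (\<Prod>n. 1 + (- (Q ^ n * w)))"

context
  fixes Q :: complex
  assumes Q: "cmod Q < 1"
begin

lemma summable_qprod: "summable (\<lambda>n. cmod (- (Q ^ n * w)))"
proof -
  have "summable (\<lambda>n. cmod Q ^ n * cmod w)"
    using Q by (intro summable_mult2 summable_geometric) simp
  thus ?thesis by (simp add: norm_mult norm_power)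
qed

text \<open>
  Splitting off the factor \<open>n = 0\<close> turns the remaining product into the one at
  \<open>Q * w\<close>. Both the quasi-periodicity and the simple zero of the theta function come from
  this recursion.
\<close>

lemma qprod_step: "qprod Q w = (1 - w) * qprod Q (Q * w)"
proof (rule LIMSEQ_unique)
  show "(\<lambda>N. \<Prod>n<Suc N. 1 + (- (Q ^ n * w))) \<longlonglongrightarrow> qprod Q w"
    unfolding qprod_def using prodinf_1_plus_LIMSEQ[OF summable_qprod] by (rule LIMSEQ_Suc)
  have "(\<Prod>n<Suc N. 1 + (- (Q ^ n * w))) = (1 - w) * (\<Prod>n<N. 1 + (- (Q ^ n * (Q * w))))" for N
    by (subst prod.lessThan_Suc_shift) (simp add: mult_ac)
  thus "(\<lambda>N. \<Prod>n<Suc N. 1 + (- (Q ^ n * w))) \<longlonglongrightarrow> (1 - w) * qprod Q (Q * w)"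
    unfolding qprod_def by (simp only:) (intro tendsto_mult tendsto_const prodinf_1_plus_LIMSEQ summable_qprod)
qed

lemma qprod_eq_0D:
  assumes "qprod Q w = 0"
  shows "\<exists>n. Q ^ n * w = 1"
proof -
  have "(\<lambda>n. 1 + (- (Q ^ n * w))) has_prod qprod Q w"
    unfolding qprod_def by (intro convergent_prod_has_prod convergent_prod_1_plus summable_qprod)
  from has_prod_eq_0_iff[OF this] assms have "0 \<in> range (\<lambda>n. 1 + (- (Q ^ n * w)))" by simp
  thus ?thesis by auto
qed

lemma qprod_holomorphic: "qprod Q holomorphic_on UNIV"
proof (rule holomorphic_uniform_sequence)
  show "(\<lambda>w. \<Prod>n<N. 1 + (- (Q ^ n * w))) holomorphic_on UNIV" for N
    by (intro holomorphic_intros)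
  fix x :: complex
  have "uniformly_convergent_on (cball x 1) (\<lambda>N w. \<Prod>n<N. 1 + (- (Q ^ n * w)))"
  proof (rule uniformly_convergent_on_prod)
    show "continuous_on (cball x 1) (\<lambda>w. - (Q ^ n * w))" for n
      by (intro continuous_intros)
    show "compact (cball x 1)" by simp
    show "uniformly_convergent_on (cball x 1) (\<lambda>N w. \<Sum>n<N. cmod (- (Q ^ n * w)))"
    proof (rule Weierstrass_m_test')
      show "summable (\<lambda>n. cmod Q ^ n * (cmod x + 1))"
        using Q by (intro summable_mult2 summable_geometric) simp
      fix n w assume "w \<in> cball x 1"
      hence "cmod w \<le> cmod x + 1"
        by (metis add.commute dist_commute dist_norm mem_cball norm_triangle_sub order_trans add_left_mono)
      thus "norm (cmod (- (Q ^ n * w))) \<le> cmod Q ^ n * (cmod x + 1)"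
        by (simp add: norm_mult norm_power mult_left_mono)
    qed
  qed
  then obtain l where l: "uniform_limit (cball x 1) (\<lambda>N w. \<Prod>n<N. 1 + (- (Q ^ n * w))) l sequentially"
    by (auto simp: uniformly_convergent_on_def)
  have "l w = qprod Q w" if "w \<in> cball x 1" for w
    using LIMSEQ_unique[OF tendsto_uniform_limitI[OF l that] prodinf_1_plus_LIMSEQ[OF summable_qprod]]
    by (simp add: qprod_def)
  with l have "uniform_limit (cball x 1) (\<lambda>N w. \<Prod>n<N. 1 + (- (Q ^ n * w))) (qprod Q) sequentially"
    by (subst uniform_limit_cong'[where g = "\<lambda>N w. \<Prod>n<N. 1 + (- (Q ^ n * w))" and i = l]) auto
  thus "\<exists>d>0. cball x d \<subseteq> UNIV \<and>
          uniform_limit (cball x d) (\<lambda>N w. \<Prod>n<N. 1 + (- (Q ^ n * w))) (qprod Q) sequentially"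
    by (intro exI[of _ 1]) simp
qed simp

end

text \<open>
  This is, up to normalisation and a shift by half periods, Jacobi's theta function in its triple
  product form, without the constant factor $(Q; Q)_\infty$.
\<close>

definition theta :: "complex \<Rightarrow> complex \<Rightarrow> complex"
  where "theta \<tau> z = qprod (exp_2pi_i \<tau>) (exp_2pi_i z) * qprod (exp_2pi_i \<tau>) (exp_2pi_i (\<tau> - z))"

lemma theta_add_1: "theta \<tau> (z + 1) = theta \<tau> z"
proof -
  have "exp_2pi_i (\<tau> - z) = exp_2pi_i (\<tau> - (z + 1) + 1)" by simp
  also have "\<dots> = exp_2pi_i (\<tau> - (z + 1))" unfolding exp_2pi_i_add by simp
  finally show ?thesis by (simp add: theta_def exp_2pi_i_add)
qed

context
  fixes \<tau> :: complex
  assumes tau: "Im \<tau> > 0"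
begin

lemma exp_2pi_i_tau: "cmod (exp_2pi_i \<tau>) < 1"
  using tau by (rule norm_exp_2pi_i_less_1)

lemma theta_add_tau: "theta \<tau> (z + \<tau>) = - exp_2pi_i (- z) * theta \<tau> z"
proof -
  have 1: "qprod (exp_2pi_i \<tau>) (exp_2pi_i (- z)) = (1 - exp_2pi_i (- z)) * qprod (exp_2pi_i \<tau>) (exp_2pi_i (\<tau> - z))"
    using qprod_step[OF exp_2pi_i_tau, of "exp_2pi_i (- z)"] exp_2pi_i_add[of \<tau> "- z"] by simp
  have 2: "qprod (exp_2pi_i \<tau>) (exp_2pi_i z) = (1 - exp_2pi_i z) * qprod (exp_2pi_i \<tau>) (exp_2pi_i (z + \<tau>))"
    using qprod_step[OF exp_2pi_i_tau, of "exp_2pi_i z"] by (simp add: exp_2pi_i_add mult.commute)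
  have "1 - exp_2pi_i (- z) = - exp_2pi_i (- z) * (1 - exp_2pi_i z)"
    by (simp add: exp_2pi_i_minus field_simps)
  thus ?thesis
    by (simp add: theta_def 1 2)
qed

lemma theta_holomorphic: "theta \<tau> holomorphic_on A"
proof -
  have 1: "(\<lambda>z. qprod (exp_2pi_i \<tau>) (exp_2pi_i (a + c * z))) holomorphic_on UNIV" for a c
  proof -
    have "(qprod (exp_2pi_i \<tau>) \<circ> (exp_2pi_i \<circ> (\<lambda>z. a + c * z))) holomorphic_on UNIV"
      by (intro holomorphic_on_compose_gen[OF _ qprod_holomorphic[OF exp_2pi_i_tau]]
          holomorphic_on_compose_gen[OF _ exp_2pi_i_holomorphic[of UNIV]] holomorphic_intros) auto
    thus ?thesis by (simp add: o_def)
  qed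
  have "(\<lambda>z. qprod (exp_2pi_i \<tau>) (exp_2pi_i (0 + 1 * z)) * qprod (exp_2pi_i \<tau>) (exp_2pi_i (\<tau> + (-1) * z))) holomorphic_on UNIV"
    by (intro holomorphic_on_mult 1)
  hence "theta \<tau> holomorphic_on UNIV"
    by (simp add: theta_def[abs_def])
  thus ?thesis by (rule holomorphic_on_subset) simp
qed

lemma theta_eq_0D:
  assumes "theta \<tau> z = 0"
  shows "\<exists>m n::int. z = of_int m + of_int n * \<tau>"
proof -
  consider "qprod (exp_2pi_i \<tau>) (exp_2pi_i z) = 0" | "qprod (exp_2pi_i \<tau>) (exp_2pi_i (\<tau> - z)) = 0"
    using assms by (auto simp: theta_def)
  thus ?thesis
  proof cases
    case 1
    then obtain n where "exp_2pi_i \<tau> ^ n * exp_2pi_i z = 1"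
      using qprod_eq_0D[OF exp_2pi_i_tau] by blast
    hence "exp_2pi_i (of_nat n * \<tau> + z) = 1"
      by (simp add: exp_2pi_i_add exp_2pi_i_of_nat_mult)
    then obtain m :: int where "of_nat n * \<tau> + z = of_int m" using exp_2pi_i_eq_1D by blast
    hence "z = of_int m + of_int (- int n) * \<tau>" by (simp add: algebra_simps)
    thus ?thesis by blast
  next
    case 2
    then obtain n where "exp_2pi_i \<tau> ^ n * exp_2pi_i (\<tau> - z) = 1"
      using qprod_eq_0D[OF exp_2pi_i_tau] by blast
    hence "exp_2pi_i (of_nat n * \<tau> + (\<tau> - z)) = 1"
      unfolding exp_2pi_i_add[of "of_nat n * \<tau>"] exp_2pi_i_of_nat_mult .
    then obtain m :: int where "of_nat n * \<tau> + (\<tau> - z) = of_int m" using exp_2pi_i_eq_1D by blast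
    hence "z = of_int (- m) + of_int (int n + 1) * \<tau>" by (simp add: algebra_simps)
    thus ?thesis by blast
  qed
qed

text \<open>
  The recursion for the product isolates the only factor that vanishes at \<open>0\<close>, namely
  $1 - e^{2\pi i z}$, whose zero is simple. The cofactor at \<open>0\<close> is $(Q;Q)_\infty^2$, which is
  nonzero since $|Q| < 1$.
\<close>

lemma zorder_theta_0: "zorder (theta \<tau>) 0 = 1"
proof -
  define H where "H = (\<lambda>z. qprod (exp_2pi_i \<tau>) (exp_2pi_i (\<tau> + z)) * qprod (exp_2pi_i \<tau>) (exp_2pi_i (\<tau> - z)))"
  have "(qprod (exp_2pi_i \<tau>) \<circ> (exp_2pi_i \<circ> (\<lambda>z. \<tau> + c * z))) holomorphic_on UNIV" for c
    by (intro holomorphic_on_compose_gen[OF _ qprod_holomorphic[OF exp_2pi_i_tau]]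
          holomorphic_on_compose_gen[OF _ exp_2pi_i_holomorphic[of UNIV]] holomorphic_intros) auto
  from holomorphic_on_mult[OF this[of 1] this[of "-1"]] have "H holomorphic_on UNIV"
    by (simp add: H_def o_def)
  hence H': "(H has_field_derivative deriv H 0) (at 0)"
    by (simp add: holomorphic_derivI)
  have "theta \<tau> z = (1 - exp_2pi_i z) * H z" for z
    unfolding theta_def H_def exp_2pi_i_add qprod_step[OF exp_2pi_i_tau, of "exp_2pi_i z"] by simp
  hence "theta \<tau> = (\<lambda>z. (1 - exp_2pi_i z) * H z)" by (rule ext)
  hence "(theta \<tau> has_field_derivative (0 - 2 * of_real pi * \<i> * exp_2pi_i 0) * H 0 + deriv H 0 * (1 - exp_2pi_i 0)) (at 0)"
    by (simp only:) (intro DERIV_mult DERIV_diff DERIV_const has_field_derivative_exp_2pi_i H')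
  hence D: "deriv (theta \<tau>) 0 = - 2 * of_real pi * \<i> * H 0"
    by (simp add: DERIV_imp_deriv)
  have "qprod (exp_2pi_i \<tau>) (exp_2pi_i \<tau>) \<noteq> 0"
  proof
    assume "qprod (exp_2pi_i \<tau>) (exp_2pi_i \<tau>) = 0"
    then obtain n where "exp_2pi_i \<tau> ^ n * exp_2pi_i \<tau> = 1" using qprod_eq_0D[OF exp_2pi_i_tau] by blast
    hence "cmod (exp_2pi_i \<tau>) ^ Suc n = 1" by (metis norm_one norm_power power_Suc2)
    moreover have "cmod (exp_2pi_i \<tau>) ^ Suc n < 1"
      using exp_2pi_i_tau by (intro power_Suc_less_one) auto
    ultimately show False by simp
  qed
  hence H0: "H 0 \<noteq> 0" by (simp add: H_def)
  show ?thesis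
  proof (rule zorder_zero_eqI')
    show "theta \<tau> analytic_on {0}"
      using theta_holomorphic[of UNIV] by (simp add: analytic_on_open analytic_on_subset[of _ UNIV])
    show "(deriv ^^ nat 1) (theta \<tau>) 0 \<noteq> 0" using D H0 by simp
    show "(deriv ^^ i) (theta \<tau>) 0 = 0" if "i < nat 1" for i
      using that qprod_step[OF exp_2pi_i_tau, of "exp_2pi_i 0"] by (simp add: theta_def)
  qed simp
qed

lemma periodic_product_theta:
  "periodic_product t (\<lambda>x. theta \<tau> (x / of_real t - a))"
proof -
  let ?c = "2 * of_real pi * \<i> / complex_of_real t"
  have 1: "periodic_product t (\<lambda>x. qprod (exp_2pi_i \<tau>) (exp_2pi_i (x / of_real t - a)))"
    unfolding periodic_product_def
  proof (intro exI conjI allI)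
    show "summable (\<lambda>n. cmod (- (exp_2pi_i \<tau> ^ n * exp_2pi_i (- a))))"
      by (rule summable_qprod[OF exp_2pi_i_tau])
    show "(1::complex) \<in> {1, -1}" for n :: nat by simp
    fix x
    have "exp_2pi_i (x / of_real t - a) = exp_2pi_i (- a) * exp (1 * ?c * x)"
      using exp_2pi_i_add[of "- a" "x / of_real t"] by (simp add: exp_2pi_i_def)
    thus "qprod (exp_2pi_i \<tau>) (exp_2pi_i (x / of_real t - a)) = (\<Prod>n. 1 + - (exp_2pi_i \<tau> ^ n * exp_2pi_i (- a)) * exp (1 * ?c * x))"
      by (simp add: qprod_def mult.assoc)
  qed
  have 2: "periodic_product t (\<lambda>x. qprod (exp_2pi_i \<tau>) (exp_2pi_i (\<tau> - (x / of_real t - a))))"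
    unfolding periodic_product_def
  proof (intro exI conjI allI)
    show "summable (\<lambda>n. cmod (- (exp_2pi_i \<tau> ^ n * exp_2pi_i (\<tau> + a))))"
      by (rule summable_qprod[OF exp_2pi_i_tau])
    show "(-1::complex) \<in> {1, -1}" for n :: nat by simp
    fix x
    have "exp_2pi_i (\<tau> - (x / of_real t - a)) = exp_2pi_i (\<tau> + a) * exp (-1 * ?c * x)"
      using exp_2pi_i_add[of "\<tau> + a" "- (x / of_real t)"] by (simp add: exp_2pi_i_def algebra_simps)
    thus "qprod (exp_2pi_i \<tau>) (exp_2pi_i (\<tau> - (x / of_real t - a))) =
            (\<Prod>n. 1 + - (exp_2pi_i \<tau> ^ n * exp_2pi_i (\<tau> + a)) * exp (-1 * ?c * x))"
      by (simp add: qprod_def mult.assoc)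
  qed
  show ?thesis
    unfolding theta_def using periodic_product_mult[OF 1 2] .
qed

end

section \<open>Factorization of elliptic functions of the second kind\<close>

text \<open>
  The period parallelogram is half-open so that, for \<open>\<tau>\<close> not real, it contains exactly
  one point of each class modulo $\mathbf{Z} + \mathbf{Z}\tau$: no zero or pole is counted twice.
\<close>

definition cell :: "complex \<Rightarrow> complex set"
  where "cell \<tau> = {of_real r + of_real s * \<tau> | r s. 0 \<le> r \<and> r < 1 \<and> 0 \<le> s \<and> s < 1}"

lemma cell_subset_compact:
  "\<exists>K. compact K \<and> cell \<tau> \<subseteq> K"
proof (intro exI conjI)
  show "compact ((\<lambda>(r, s). complex_of_real r + of_real s * \<tau>) ` ({0..1} \<times> {0..1}))"
    by (intro compact_continuous_image compact_Times compact_Icc)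
       (auto simp: case_prod_beta intro!: continuous_intros)
  show "cell \<tau> \<subseteq> (\<lambda>(r, s). complex_of_real r + of_real s * \<tau>) ` ({0..1} \<times> {0..1})"
  proof
    fix z assume "z \<in> cell \<tau>"
    then obtain r s where "z = of_real r + of_real s * \<tau>" "(r, s) \<in> {0..1} \<times> {0..1}"
      by (auto simp: cell_def)
    thus "z \<in> (\<lambda>(r, s). complex_of_real r + of_real s * \<tau>) ` ({0..1} \<times> {0..1})"
      by (metis (no_types, lifting) case_prod_conv image_eqI)
  qed
qed

lemma cell_representative:
  assumes "Im \<tau> \<noteq> 0"
  shows "\<exists>w (m::int) (n::int). w \<in> cell \<tau> \<and> z = w + of_int m + of_int n * \<tau>"
proof -
  define s where "s = Im z / Im \<tau>"
  define r where "r = Re z - s * Re \<tau>"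
  have z: "z = of_real r + of_real s * \<tau>"
    using assms by (simp add: complex_eq_iff r_def s_def)
  let ?w = "of_real (frac r) + of_real (frac s) * \<tau>"
  have "?w \<in> cell \<tau>"
    unfolding cell_def using frac_ge_0 frac_lt_1 by blast
  moreover have "z = ?w + of_int \<lfloor>r\<rfloor> + of_int \<lfloor>s\<rfloor> * \<tau>"
    unfolding z frac_def by (simp add: algebra_simps)
  ultimately show ?thesis by blast
qed

lemma cell_unique:
  assumes "Im \<tau> \<noteq> 0" "z \<in> cell \<tau>" "w \<in> cell \<tau>" "z - w = of_int m + of_int n * \<tau>"
  shows "z = w"
proof -
  obtain r s where z: "z = of_real r + of_real s * \<tau>" "0 \<le> r" "r < 1" "0 \<le> s" "s < 1"
    using assms(2) unfolding cell_def by blast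
  obtain r' s' where w: "w = of_real r' + of_real s' * \<tau>" "0 \<le> r'" "r' < 1" "0 \<le> s'" "s' < 1"
    using assms(3) unfolding cell_def by blast
  have "Im (z - w) = Im (of_int m + of_int n * \<tau>)" by (simp only: assms(4))
  hence "(s - s') * Im \<tau> = of_int n * Im \<tau>" by (simp add: z w algebra_simps)
  hence n: "s - s' = of_int n" using assms(1) by simp
  hence "\<bar>real_of_int n\<bar> < 1" using z w by linarith
  hence n0: "n = 0" by linarith
  have "Re (z - w) = Re (of_int m + of_int n * \<tau>)" by (simp only: assms(4))
  hence m: "r - r' = of_int m" using n0 n by (simp add: z w)
  hence "\<bar>real_of_int m\<bar> < 1" using z w by linarith
  hence "m = 0" by linarith
  with assms(4) n0 show ?thesis by simp
qed

lemma doubly_periodic_induct: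
  fixes P :: "complex \<Rightarrow> bool"
  assumes "Im \<tau> \<noteq> 0" "\<And>z. P (z + 1) \<longleftrightarrow> P z" "\<And>z. P (z + \<tau>) \<longleftrightarrow> P z"
    and "\<And>z. z \<in> cell \<tau> \<Longrightarrow> P z"
  shows "P z"
proof -
  have period: "P (z + of_int m * p) \<longleftrightarrow> P z" if p: "\<And>z. P (z + p) \<longleftrightarrow> P z" for p z and m :: int
  proof (induction m rule: int_induct[where k = 0])
    case base
    show ?case by simp
  next
    case (step1 i)
    have "P (z + of_int (i + 1) * p) \<longleftrightarrow> P (z + of_int i * p + p)"
      by (simp add: algebra_simps)
    thus ?case using p step1 by simp
  next
    case (step2 i)
    have "P (z + of_int i * p) \<longleftrightarrow> P (z + of_int (i - 1) * p + p)"
      by (simp add: algebra_simps)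
    thus ?case using p step2 by simp
  qed
  obtain w m n where w: "w \<in> cell \<tau>" and z: "z = w + of_int m + of_int n * \<tau>"
    using cell_representative[OF assms(1)] by blast
  have "P (w + of_int m * 1 + of_int n * \<tau>) \<longleftrightarrow> P w"
    using period[OF assms(3)] period[OF assms(2)] by blast
  thus ?thesis using assms(4)[OF w] z by simp
qed

text \<open>
  All values are taken on a compact parallelogram, so Liouville's theorem applies.
\<close>

lemma doubly_periodic_entire_constant:
  assumes "Im \<tau> \<noteq> 0" "g holomorphic_on UNIV" "\<And>z. g (z + 1) = g z" "\<And>z. g (z + \<tau>) = g z"
  shows "\<exists>c. \<forall>z. g z = c"
proof -
  obtain K where K: "compact K" "cell \<tau> \<subseteq> K" using cell_subset_compact by blast
  have "g z \<in> g ` K" for z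
    by (rule doubly_periodic_induct[OF assms(1), where P = "\<lambda>z. g z \<in> g ` K"])
       (use K assms in auto)
  hence "range g \<subseteq> g ` K" by blast
  moreover have "bounded (g ` K)"
    by (intro compact_imp_bounded compact_continuous_image K(1) holomorphic_on_imp_continuous_on
        holomorphic_on_subset[OF assms(2)]) simp
  ultimately have "bounded (range g)" by (rule bounded_subset[rotated])
  with assms(2) have "g constant_on UNIV" by (rule Liouville_theorem)
  thus ?thesis by (auto simp: constant_on_def)
qed

text \<open>
  The logarithmic derivative \<open>h\<close> is entire, has period \<open>1\<close> and increases by a
  constant under $z \mapsto z + \tau$. So \<open>h'\<close> is doubly periodic and hence constant, which
  makes \<open>h\<close> affine; an affine function of period \<open>1\<close> is constant.
\<close>

lemma entire_quasiperiodic_nonvanishing: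
  assumes tau: "Im \<tau> \<noteq> 0" and hol: "G holomorphic_on UNIV" and nz: "\<And>z. G z \<noteq> 0"
    and per1: "\<And>z. G (z + 1) = \<rho> * G z" and pert: "\<And>z. G (z + \<tau>) = c * exp (m * z) * G z"
  shows "\<exists>C b. C \<noteq> 0 \<and> (\<forall>z. G z = C * exp (b * z))"
proof -
  define h where "h = (\<lambda>z. deriv G z / G z)"
  have D: "(G has_field_derivative deriv G z) (at z)" for z
    using hol by (rule holomorphic_derivI) auto
  have hhol: "h holomorphic_on UNIV"
    unfolding h_def using nz by (intro holomorphic_intros holomorphic_deriv hol) auto
  have Dh: "(h has_field_derivative deriv h z) (at z)" for z
    using hhol by (rule holomorphic_derivI) auto
  have h1: "h (z + 1) = h z" for z
  proof -
    have "deriv (\<lambda>z. G (z + 1)) z = deriv (\<lambda>z. \<rho> * G z) z" by (simp only: per1)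
    hence "deriv G (z + 1) = \<rho> * deriv G z"
      unfolding deriv_shift_arg using DERIV_imp_deriv[OF DERIV_cmult[OF D]] by simp
    moreover have "\<rho> \<noteq> 0" using per1[of z] nz[of "z + 1"] by auto
    ultimately show ?thesis by (simp add: h_def per1)
  qed
  have ht: "h (z + \<tau>) = m + h z" for z
  proof -
    have c: "c \<noteq> 0" using pert[of z] nz[of "z + \<tau>"] by auto
    have E: "((\<lambda>z. c * exp (m * z)) has_field_derivative c * (exp (m * z) * m)) (at z)"
      by (intro DERIV_cmult DERIV_fun_exp DERIV_cmult_Id)
    have "deriv (\<lambda>z. G (z + \<tau>)) z = deriv (\<lambda>z. c * exp (m * z) * G z) z" by (simp only: pert)
    also have "\<dots> = c * (exp (m * z) * m) * G z + deriv G z * (c * exp (m * z))"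
      using DERIV_mult[OF E D] by (rule DERIV_imp_deriv)
    finally have "deriv G (z + \<tau>) = c * exp (m * z) * (m * G z + deriv G z)"
      unfolding deriv_shift_arg by (simp add: algebra_simps)
    thus ?thesis using c nz[of z] by (simp add: h_def pert add_divide_distrib)
  qed
  have "\<exists>a. \<forall>z. deriv h z = a"
  proof (rule doubly_periodic_entire_constant[OF tau])
    show "deriv h holomorphic_on UNIV" by (intro holomorphic_deriv hhol) auto
    fix z
    have "deriv (\<lambda>z. h (z + 1)) z = deriv h z" by (simp only: h1)
    thus "deriv h (z + 1) = deriv h z" by (simp only: deriv_shift_arg)
    have "deriv (\<lambda>z. h (z + \<tau>)) z = deriv (\<lambda>z. m + h z) z" by (simp only: ht)
    thus "deriv h (z + \<tau>) = deriv h z"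
      using DERIV_imp_deriv[OF DERIV_add[OF DERIV_const Dh]] by (simp add: deriv_shift_arg)
  qed
  then obtain a where a: "\<And>z. deriv h z = a" by blast
  have "(\<lambda>z. h z - a * z) constant_on UNIV"
  proof (rule has_field_derivative_0_imp_constant_on)
    fix z
    show "((\<lambda>z. h z - a * z) has_field_derivative 0) (at z)"
      using DERIV_diff[OF Dh DERIV_cmult_Id[of a]] a by simp
  qed auto
  then obtain b where b: "\<And>z. h z - a * z = b" by (auto simp: constant_on_def)
  have "a = 0" using b[of 1] b[of 0] h1[of 0] by simp
  with b have hb: "h z = b" for z by (metis diff_0_right mult_zero_left)
  hence Gb: "deriv G z = b * G z" for z
    using nz[of z] unfolding h_def by (metis nonzero_eq_divide_eq)
  have "(\<lambda>z. G z * exp (- b * z)) constant_on UNIV"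
  proof (rule has_field_derivative_0_imp_constant_on)
    fix z
    have "((\<lambda>z. exp (- b * z)) has_field_derivative exp (- b * z) * (- b)) (at z)"
      by (intro DERIV_fun_exp DERIV_cmult_Id)
    from DERIV_mult[OF D this]
    show "((\<lambda>z. G z * exp (- b * z)) has_field_derivative 0) (at z)"
      by (simp add: Gb algebra_simps)
  qed auto
  then obtain C where C: "\<And>z. G z * exp (- b * z) = C" by (auto simp: constant_on_def)
  have "G z = C * exp (b * z)" for z
    unfolding C[of z, symmetric] by (simp add: mult.assoc flip: exp_add)
  moreover have "C \<noteq> 0" using C[of 0] nz[of 0] by auto
  ultimately show ?thesis by blast
qed

text \<open>
  Order zero at a point means that the singularity there is removable with a nonzero value.
\<close>

lemma meromorphic_zorder_0_entire:
  assumes mero: "F meromorphic_on UNIV" and nz: "\<forall>\<^sub>\<approx>z. F z \<noteq> 0" and ord: "\<And>z. zorder F z = 0"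
  shows "\<exists>G. G holomorphic_on UNIV \<and> (\<forall>z. G z \<noteq> 0) \<and> (\<forall>\<^sub>\<approx>z. F z = G z)"
proof (intro exI conjI allI)
  let ?G = "remove_sings F"
  have m: "F meromorphic_on {z}" for z
    using mero by (rule meromorphic_on_subset) simp
  have iso: "isolated_singularity_at F z" "not_essential F z" for z
    using m[of z] by (auto simp: meromorphic_at_iff)
  have ana: "?G analytic_on {z}" for z
  proof -
    have "\<not> is_pole F z"
      using isolated_pole_imp_neg_zorder[OF iso(1)[of z]] ord[of z] by auto
    then obtain c where "F \<midarrow>z\<rightarrow> c"
      using iso(2)[of z] unfolding not_essential_def by blast
    with iso(1) show ?thesis by (rule remove_sings_analytic_at)
  qed
  show "?G holomorphic_on UNIV"
    by (rule analytic_imp_holomorphic, rule analytic_on_analytic_at[THEN iffD2], rule ballI, rule ana)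
  have eq: "\<forall>\<^sub>\<approx>z. ?G z = F z" using mero by (rule eventually_remove_sings_eq)
  thus "\<forall>\<^sub>\<approx>z. F z = ?G z" by eventually_elim simp
  fix z
  have "\<forall>\<^sub>\<approx>z. ?G z \<noteq> 0" using eq nz by eventually_elim simp
  hence "\<forall>\<^sub>F w in at z. ?G w \<noteq> 0" by (rule eventually_cosparse_imp_eventually_at) simp
  hence "\<exists>\<^sub>F w in at z. ?G w \<noteq> 0" by (rule eventually_frequently[rotated]) simp
  moreover have "zorder ?G z = 0" using iso ord by simp
  ultimately show "?G z \<noteq> 0" using zorder_eq_0_iff[OF ana] by blast
qed

text \<open>
  A functional equation whose factor has no zeros moves zeros and poles to zeros and poles of the
  same order. It reduces statements on orders to points of one cell.
\<close>

lemma zorder_eq_shift: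
  assumes "\<forall>\<^sub>\<approx>z. F (z + p) = a z * F z" "F meromorphic_on UNIV" "\<forall>\<^sub>\<approx>z. F z \<noteq> 0"
    and "a holomorphic_on UNIV" "\<And>z. a z \<noteq> 0"
  shows "zorder F (z + p) = zorder F z"
proof -
  have ana: "a analytic_on {z}"
    using assms(4) by (simp add: analytic_on_open analytic_on_subset[of _ UNIV])
  have freq: "\<exists>\<^sub>F w in at z. F w \<noteq> 0" "\<exists>\<^sub>F w in at z. a w \<noteq> 0"
    using eventually_cosparse_imp_eventually_at[OF assms(3), of z UNIV] assms(5)
    by (auto intro: eventually_frequently)
  have "zorder F (z + p) = zorder (\<lambda>w. F (w + p)) z"
    unfolding zorder_shift[of F "z + p"] zorder_shift[of "\<lambda>w. F (w + p)" z] by (simp add: add.assoc)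
  also have "\<dots> = zorder (\<lambda>w. a w * F w) z"
    using assms(1) by (intro zorder_cong eventually_cosparse_imp_eventually_at) auto
  also have "\<dots> = zorder a z + zorder F z"
    using freq analytic_on_imp_meromorphic_on[OF ana] meromorphic_on_subset[OF assms(2), of "{z}"]
    by (intro zorder_mult) auto
  also have "zorder a z = 0" using ana assms(5) by (rule zorder_eq_0I)
  finally show ?thesis by simp
qed

lemma theta_shift_analytic:
  assumes "Im \<tau> > 0"
  shows "(\<lambda>z. theta \<tau> (z - a)) analytic_on A"
proof -
  have "(theta \<tau> \<circ> (\<lambda>z. z - a)) holomorphic_on UNIV"
    by (intro holomorphic_on_compose_gen[OF _ theta_holomorphic[OF assms, of UNIV]] holomorphic_intros) auto
  hence "(theta \<tau> \<circ> (\<lambda>z. z - a)) analytic_on UNIV"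
    by (simp add: analytic_on_open)
  thus ?thesis unfolding o_def by (rule analytic_on_subset) simp
qed

lemma theta_shift_meromorphic:
  assumes "Im \<tau> > 0"
  shows "(\<lambda>z. theta \<tau> (z - a)) meromorphic_on A"
  using theta_shift_analytic[OF assms] by (rule analytic_on_imp_meromorphic_on)

text \<open>
  The imaginary part of \<open>\<tau> / 2\<close> is not an integral multiple of that of
  \<open>\<tau>\<close>, so this is not a lattice point. Hence the theta function is not identically zero.
\<close>

lemma theta_half_period_nonzero:
  assumes "Im \<tau> > 0"
  shows "theta \<tau> (\<tau> / 2) \<noteq> 0"
proof
  assume "theta \<tau> (\<tau> / 2) = 0"
  then obtain m n :: int where "\<tau> / 2 = of_int m + of_int n * \<tau>"
    using theta_eq_0D[OF assms] by blast
  hence "Im (\<tau> / 2) = Im (of_int m + of_int n * \<tau>)" by (rule arg_cong)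
  hence "real_of_int (2 * n) = 1" using assms by simp
  hence "2 * n = 1" by linarith
  thus False by presburger
qed

lemma theta_shift_nonzero:
  assumes "Im \<tau> > 0"
  shows "\<forall>\<^sub>\<approx>z. theta \<tau> (z - a) \<noteq> 0"
proof (rule meromorphic_nonzero_cosparse)
  show "(\<lambda>z. theta \<tau> (z - a)) meromorphic_on UNIV"
    using assms by (rule theta_shift_meromorphic)
  show "\<not> (\<forall>\<^sub>\<approx>z. theta \<tau> (z - a) = 0)"
  proof
    assume "\<forall>\<^sub>\<approx>z. theta \<tau> (z - a) = 0"
    from cosparse_shift[OF this, of a] have "\<forall>\<^sub>\<approx>z. theta \<tau> z = (\<lambda>_. 0) z" by simp
    from cosparse_eq_entire[OF theta_holomorphic[OF assms] holomorphic_on_const this, of "\<tau> / 2"]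
    show False using theta_half_period_nonzero[OF assms] by simp
  qed
qed

lemma zorder_theta_cell:
  assumes tau: "Im \<tau> > 0" and za: "z \<in> cell \<tau>" "a \<in> cell \<tau>"
  shows "zorder (\<lambda>w. theta \<tau> (w - a)) z = (if z = a then 1 else 0)"
proof (cases "z = a")
  case True
  have "zorder (\<lambda>w. theta \<tau> (w - a)) a = zorder (theta \<tau>) 0"
    by (subst zorder_shift) simp
  thus ?thesis using True zorder_theta_0[OF tau] by simp
next
  case False
  have "theta \<tau> (z - a) \<noteq> 0"
  proof
    assume "theta \<tau> (z - a) = 0"
    then obtain m n :: int where "z - a = of_int m + of_int n * \<tau>"
      using theta_eq_0D[OF tau] by blast
    with cell_unique[of \<tau> z a m n] tau za False show False by simp
  qed
  with theta_shift_analytic[OF tau] have "zorder (\<lambda>w. theta \<tau> (w - a)) z = 0"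
    by (rule zorder_eq_0I)
  with False show ?thesis by simp
qed

text \<open>
  Each factor picks up a constant and a power of $e^{-2\pi i z}$, so the exponent is
  $m = -2\pi i \sum_a n_a$.
\<close>

lemma theta_product_add_tau:
  assumes tau: "Im \<tau> > 0" and fin: "finite Z"
  shows "\<exists>c m. c \<noteq> 0 \<and> (\<forall>z. (\<Prod>a\<in>Z. theta \<tau> (z + \<tau> - a) powi n a) =
            c * exp (m * z) * (\<Prod>a\<in>Z. theta \<tau> (z - a) powi n a))"
  using fin
proof (induction Z rule: finite_induct)
  case empty
  have "(1::complex) \<noteq> 0 \<and> (\<forall>z::complex. 1 = 1 * exp (0 * z) * 1)" by simp
  thus ?case unfolding prod.empty by blast
next
  case (insert a Z)
  then obtain c m where c: "c \<noteq> 0"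
    and cm: "\<And>z. (\<Prod>a\<in>Z. theta \<tau> (z + \<tau> - a) powi n a) = c * exp (m * z) * (\<Prod>a\<in>Z. theta \<tau> (z - a) powi n a)"
    by blast
  define m' where "m' = - (2 * of_real pi * \<i>)"
  have one: "theta \<tau> (z + \<tau> - a) powi n a
      = (- exp_2pi_i a) powi n a * exp ((of_int (n a) * m') * z) * theta \<tau> (z - a) powi n a" for z
  proof -
    have "theta \<tau> (z + \<tau> - a) = - exp_2pi_i (- (z - a)) * theta \<tau> (z - a)"
      using theta_add_tau[OF tau, of "z - a"] by (simp add: algebra_simps)
    also have "- exp_2pi_i (- (z - a)) = - exp_2pi_i a * exp (m' * z)"
      using exp_2pi_i_add[of a "- z"] by (simp add: exp_2pi_i_def m'_def)
    finally have "theta \<tau> (z + \<tau> - a) powi n a = (- exp_2pi_i a * exp (m' * z) * theta \<tau> (z - a)) powi n a"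
      by (rule arg_cong)
    also have "\<dots> = (- exp_2pi_i a) powi n a * exp (m' * z) powi n a * theta \<tau> (z - a) powi n a"
      by (simp only: power_int_mult_distrib)
    also have "exp (m' * z) powi n a = exp ((of_int (n a) * m') * z)"
      by (simp add: exp_power_int mult_ac)
    finally show ?thesis .
  qed
  have "(\<Prod>a\<in>insert a Z. theta \<tau> (z + \<tau> - a) powi n a) =
      ((- exp_2pi_i a) powi n a * c) * exp ((of_int (n a) * m' + m) * z) * (\<Prod>a\<in>insert a Z. theta \<tau> (z - a) powi n a)" for z
  proof -
    have "exp ((of_int (n a) * m' + m) * z) = exp ((of_int (n a) * m') * z) * exp (m * z)"
      by (simp only: distrib_right exp_add)
    thus ?thesis
      unfolding prod.insert[OF insert.hyps] one cm by (simp only: mult_ac)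
  qed
  moreover have "(- exp_2pi_i a) powi n a * c \<noteq> 0"
    using c by (simp add: power_int_eq_0_iff)
  ultimately show ?case by blast
qed

text \<open>
  Divide \<open>f\<close> by the product of theta functions with the same zeros and poles in the cell. The
  quotient has order zero in the cell, hence everywhere by its functional equations, and is
  therefore an exponential.
\<close>

theorem second_kind_theta_factorization:
  assumes tau: "Im \<tau> > 0" and mero: "f meromorphic_on UNIV" and nz: "\<not> (\<forall>\<^sub>\<approx>z. f z = 0)"
    and p1: "\<forall>\<^sub>\<approx>z. f (z + 1) = \<rho> * f z" and pt: "\<forall>\<^sub>\<approx>z. f (z + \<tau>) = \<sigma> * f z"
    and rs: "\<rho> \<noteq> 0" "\<sigma> \<noteq> 0"
  shows "\<exists>Z n C b. finite Z \<and> C \<noteq> 0 \<and>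
           (\<forall>\<^sub>\<approx>z. f z = C * exp (b * z) * (\<Prod>a\<in>Z. theta \<tau> (z - a) powi n a))"
proof -
  have fnz: "\<forall>\<^sub>\<approx>z. f z \<noteq> 0" using mero nz by (rule meromorphic_nonzero_cosparse)
  define n where "n = zorder f"
  define Z where "Z = {z \<in> cell \<tau>. n z \<noteq> 0}"
  define T where "T = (\<lambda>z. \<Prod>a\<in>Z. theta \<tau> (z - a) powi n a)"
  define F where "F = (\<lambda>z. f z / T z)"
  have "\<forall>\<^sub>\<approx>z. zorder f z = 0"
    using cosparse_analytic[OF mero] fnz by eventually_elim (rule zorder_eq_0I)
  hence "{z. n z \<noteq> 0} sparse_in UNIV" by (simp add: eventually_cosparse n_def)
  moreover obtain K where K: "compact K" "cell \<tau> \<subseteq> K" using cell_subset_compact by blast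
  ultimately have "finite (K \<inter> {z. n z \<noteq> 0})"
    by (meson sparse_in_compact_finite sparse_in_subset subset_UNIV)
  hence fin: "finite Z" by (rule finite_subset[rotated]) (use K in \<open>auto simp: Z_def\<close>)
  have theta_mero: "(\<lambda>z. theta \<tau> (z - a) powi n a) meromorphic_on A" for a A
    by (intro meromorphic_intros theta_shift_meromorphic[OF tau])
  have Tmero: "T meromorphic_on A" for A
    unfolding T_def by (intro meromorphic_on_prod theta_mero)
  have "\<forall>\<^sub>\<approx>z. \<forall>a\<in>Z. theta \<tau> (z - a) \<noteq> 0"
    using fin theta_shift_nonzero[OF tau] by (simp add: eventually_ball_finite)
  hence Tnz: "\<forall>\<^sub>\<approx>z. T z \<noteq> 0"
    by eventually_elim (use fin in \<open>simp add: T_def power_int_eq_0_iff\<close>)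
  have Fmero: "F meromorphic_on UNIV"
    unfolding F_def by (intro meromorphic_intros mero Tmero)
  have Fnz: "\<forall>\<^sub>\<approx>z. F z \<noteq> 0"
    using fnz Tnz by eventually_elim (simp add: F_def)
  have evat: "\<forall>\<^sub>F w in at z. P w" if "\<forall>\<^sub>\<approx>z. P z" for P and z :: complex
    using that by (rule eventually_cosparse_imp_eventually_at) simp
  have freq: "\<exists>\<^sub>F w in at z. P w" if "\<forall>\<^sub>\<approx>z. P z" for P and z :: complex
    using evat[OF that] by (rule eventually_frequently[rotated]) simp
  have ordT: "zorder T z = n z" if z: "z \<in> cell \<tau>" for z
  proof -
    have "zorder T z = (\<Sum>a\<in>Z. zorder (\<lambda>z. theta \<tau> (z - a) powi n a) z)"
      unfolding T_def by (intro zorder_prod theta_mero evat Tnz[unfolded T_def])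
    also have "\<dots> = (\<Sum>a\<in>Z. n a * zorder (\<lambda>z. theta \<tau> (z - a)) z)"
      by (intro sum.cong refl zorder_power_int theta_shift_meromorphic[OF tau] freq theta_shift_nonzero[OF tau])
    also have "\<dots> = (\<Sum>a\<in>Z. if z = a then n a else 0)"
      by (intro sum.cong refl) (use zorder_theta_cell[OF tau z] in \<open>auto simp: Z_def\<close>)
    also have "\<dots> = n z" using fin z by (auto simp: Z_def)
    finally show ?thesis .
  qed
  have ord_cell: "zorder F z = 0" if z: "z \<in> cell \<tau>" for z
  proof -
    have "zorder F z = zorder f z - zorder T z"
      unfolding F_def
      by (intro zorder_divide Tmero freq fnz Tnz meromorphic_on_subset[OF mero]) auto
    thus ?thesis using ordT[OF z] by (simp add: n_def)
  qed
  have T1: "T (z + 1) = T z" for z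
  proof -
    have "theta \<tau> (z + 1 - a) = theta \<tau> (z - a)" for a
      using theta_add_1[of \<tau> "z - a"] by (simp add: algebra_simps)
    thus ?thesis by (simp add: T_def)
  qed
  obtain c m where c: "c \<noteq> 0" and Tt: "\<And>z. T (z + \<tau>) = c * exp (m * z) * T z"
    using theta_product_add_tau[OF tau fin, of n] unfolding T_def by blast
  have F1: "\<forall>\<^sub>\<approx>z. F (z + 1) = \<rho> * F z"
    using p1 by eventually_elim (simp add: F_def T1)
  have Ft: "\<forall>\<^sub>\<approx>z. F (z + \<tau>) = (\<sigma> / c) * exp (- m * z) * F z"
    using pt by eventually_elim (simp add: F_def Tt exp_minus field_simps)
  have "zorder F z = 0" for z
  proof (rule doubly_periodic_induct[where P = "\<lambda>z. zorder F z = 0" and \<tau> = \<tau>])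
    fix z
    show "zorder F (z + 1) = 0 \<longleftrightarrow> zorder F z = 0"
      using zorder_eq_shift[OF F1 Fmero Fnz, of z] rs by simp
    have "zorder F (z + \<tau>) = zorder F z"
      by (rule zorder_eq_shift[OF Ft Fmero Fnz]) (use rs c in \<open>auto intro!: holomorphic_intros\<close>)
    thus "zorder F (z + \<tau>) = 0 \<longleftrightarrow> zorder F z = 0" by simp
  qed (use tau ord_cell in auto)
  from meromorphic_zorder_0_entire[OF Fmero Fnz this]
  obtain G where G: "G holomorphic_on UNIV" "\<And>z. G z \<noteq> 0" and FG: "\<forall>\<^sub>\<approx>z. F z = G z" by blast
  have Gshift: "(\<lambda>z. G (z + p)) holomorphic_on UNIV" for p
  proof -
    have "(G \<circ> (\<lambda>z. z + p)) holomorphic_on UNIV"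
      by (intro holomorphic_on_compose_gen[OF _ G(1)] holomorphic_intros) auto
    thus ?thesis by (simp add: o_def)
  qed
  have G1: "G (z + 1) = \<rho> * G z" for z
  proof (rule cosparse_eq_entire[OF Gshift, where z = z])
    show "(\<lambda>z. \<rho> * G z) holomorphic_on UNIV" by (intro holomorphic_intros G)
    show "\<forall>\<^sub>\<approx>z. G (z + 1) = \<rho> * G z"
      using F1 FG cosparse_shift[OF FG, of 1] by eventually_elim simp
  qed
  have Gt: "G (z + \<tau>) = (\<sigma> / c) * exp (- m * z) * G z" for z
  proof (rule cosparse_eq_entire[OF Gshift, where z = z])
    show "(\<lambda>z. (\<sigma> / c) * exp (- m * z) * G z) holomorphic_on UNIV" by (intro holomorphic_intros G c)
    show "\<forall>\<^sub>\<approx>z. G (z + \<tau>) = (\<sigma> / c) * exp (- m * z) * G z"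
      using Ft FG cosparse_shift[OF FG, of \<tau>] by eventually_elim simp
  qed
  have "\<exists>C b. C \<noteq> 0 \<and> (\<forall>z. G z = C * exp (b * z))"
    by (rule entire_quasiperiodic_nonvanishing[OF _ G(1) G(2) G1 Gt]) (use tau in simp)
  then obtain C b where C: "C \<noteq> 0" and CG: "\<And>z. G z = C * exp (b * z)" by blast
  have "\<forall>\<^sub>\<approx>z. f z = C * exp (b * z) * (\<Prod>a\<in>Z. theta \<tau> (z - a) powi n a)"
    using FG Tnz
  proof eventually_elim
    case (elim z)
    have "f z = F z * T z" using elim(2) by (simp add: F_def)
    thus ?case by (simp only: elim(1) CG T_def)
  qed
  with fin C show ?thesis by blast
qed

section \<open>Quotients of tau functions\<close>

text \<open>
  The diagonal system $A = \mathrm{diag}(-k_i/2)$ with $R_x = \mathrm{diag}(r_i e^{k_i x})$; the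
  factor $-1/2$ accounts for the two terms in $-R' = AR + RA$.
\<close>

lemma finite_dim_tau_exp_product:
  fixes r k :: "nat \<Rightarrow> complex"
  shows "finite_dim_tau (\<lambda>x. \<Prod>i<n. 1 + r i * exp (k i * x))"
proof -
  define A where "A = mat_diag n (\<lambda>i. - k i / 2)"
  define R where "R = (\<lambda>x. mat_diag n (\<lambda>i. r i * exp (k i * x)))"
  define B where "B = A * R 0 + R 0 * A"
  have car: "A \<in> carrier_mat n n" "R x \<in> carrier_mat n n" for x
    by (simp_all add: A_def R_def)
  have B: "B \<in> carrier_mat n n" unfolding B_def by (intro add_carrier_mat mult_carrier_mat[OF car(2) car(1)])
  have prod: "(- (A * R x + R x * A)) $$ (i, j) = (if i = j then k i * (r i * exp (k i * x)) else 0)"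
    if "i < n" "j < n" for x i j
    using that by (simp add: A_def R_def mat_diag_diag) (simp add: mat_diag_def)
  have "((\<lambda>x. R x $$ (i, j)) has_field_derivative (- (A * R x + R x * A)) $$ (i, j)) (at x)"
    if ij: "i < n" "j < n" for x i j
  proof -
    have "((\<lambda>x. r i * exp (k i * x)) has_field_derivative r i * (exp (k i * x) * k i)) (at x)"
      by (intro DERIV_cmult DERIV_fun_exp DERIV_cmult_Id)
    thus ?thesis
      unfolding prod[OF ij] using ij by (cases "i = j") (simp_all add: R_def mat_diag_def mult_ac)
  qed
  moreover have "(\<Prod>i<n. 1 + r i * exp (k i * x)) = Determinant.det (1\<^sub>m n + R x)" for x
  proof -
    have "Determinant.det (1\<^sub>m n + R x) = prod_list (diag_mat (1\<^sub>m n + R x))"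
      by (rule det_upper_triangular) (auto simp: R_def mat_diag_def upper_triangular_def)
    also have "\<dots> = (\<Prod>i<n. 1 + r i * exp (k i * x))"
      by (simp add: prod_list_diag_prod R_def mat_diag_def atLeast0LessThan)
    finally show ?thesis by simp
  qed
  moreover have "A * R 0 + R 0 * A = B * 1\<^sub>m n" 
    unfolding right_mult_one_mat[OF B] by (simp only: B_def)
  ultimately show ?thesis
    unfolding finite_dim_tau_def using car B one_carrier_mat[of n] by blast
qed

text \<open>
  The constant factor is realised by a first diagonal entry of frequency zero.
\<close>

lemma finite_dim_tau_scaled_exp: "finite_dim_tau (\<lambda>x. C * (1 + exp (b * x)))"
proof -
  have "(\<lambda>x. \<Prod>i<(2::nat). 1 + (if i = 0 then C - 1 else 1) * exp ((if i = 0 then 0 else b) * x))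
      = (\<lambda>x. C * (1 + exp (b * x)))"
    by (simp add: fun_eq_iff numeral_2_eq_2)
  thus ?thesis
    using finite_dim_tau_exp_product[where n = 2
        and r = "\<lambda>i. if i = 0 then C - 1 else 1" and k = "\<lambda>i. if i = 0 then 0 else b"]
    by simp
qed

lemma one_plus_exp_nonzero: "\<forall>\<^sub>\<approx>x::complex. 1 + exp (b * x) \<noteq> 0"
proof (rule meromorphic_nonzero_cosparse)
  have hol: "(\<lambda>x. 1 + exp (b * x)) holomorphic_on UNIV" by (intro holomorphic_intros)
  thus "(\<lambda>x. 1 + exp (b * x)) meromorphic_on UNIV"
    by (simp add: analytic_on_imp_meromorphic_on analytic_on_open)
  show "\<not> (\<forall>\<^sub>\<approx>x. 1 + exp (b * x) = 0)"
    using cosparse_eq_entire[OF hol holomorphic_on_const[of 0], of 0] by auto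
qed

lemma power_int_eq_divide:
  fixes x :: complex
  assumes "x \<noteq> 0"
  shows "x powi n = x ^ nat n / x ^ nat (- n)"
  by (cases "n \<ge> 0") (auto simp: power_int_def field_simps assms)

text \<open>
  Factors of positive order go to the numerator and those of negative order to the denominator.
  The exponential is split as $e^{bx} = (1 + e^{bx})/(1 + e^{-bx})$.
\<close>

lemma tau_quotient_theta:
  assumes tau: "Im \<tau> > 0" and t: "t \<noteq> 0" and fin: "finite Z" and C: "C \<noteq> 0"
    and f: "\<forall>\<^sub>\<approx>x. f x = C * exp (b * x) * (\<Prod>a\<in>Z. theta \<tau> (x / of_real t - a) powi n a)"
  shows "tau_quotient f"
proof -
  let ?th = "\<lambda>a x. theta \<tau> (x / of_real t - a)"
  define \<tau>1 where "\<tau>1 = (\<lambda>x. \<Prod>a\<in>Z. ?th a x ^ nat (n a))"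
  define \<tau>2 where "\<tau>2 = (\<lambda>x. \<Prod>a\<in>Z. ?th a x ^ nat (- n a))"
  have "uniformly_periodic_tau TYPE(ell2) TYPE(ell2) \<tau>1" "uniformly_periodic_tau TYPE(ell2) TYPE(ell2) \<tau>2"
    unfolding \<tau>1_def \<tau>2_def
    by (intro uniformly_periodic_tau_periodic_product[OF _ t] periodic_product_prod
          periodic_product_power periodic_product_theta[OF tau])+
  moreover have "finite_dim_tau (\<lambda>x. C * (1 + exp (b * x)))" "finite_dim_tau (\<lambda>x. 1 * (1 + exp (- b * x)))"
    by (rule finite_dim_tau_scaled_exp)+
  moreover have "\<forall>\<^sub>\<approx>x. \<tau>2 x * (1 * (1 + exp (- b * x))) \<noteq> 0 \<and>
      f x = (\<tau>1 x * (C * (1 + exp (b * x)))) / (\<tau>2 x * (1 * (1 + exp (- b * x))))"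
  proof -
    have "\<forall>\<^sub>\<approx>x. ?th a x \<noteq> 0" for a
      using cosparse_compose_affine[OF theta_shift_nonzero[OF tau, of a], of "1 / of_real t" 0] t
      by simp
    hence "\<forall>\<^sub>\<approx>x. \<forall>a\<in>Z. ?th a x \<noteq> 0"
      using fin by (simp add: eventually_ball_finite)
    with f one_plus_exp_nonzero[of "- b"] show ?thesis
    proof eventually_elim
      case (elim x)
      have \<tau>2: "\<tau>2 x \<noteq> 0" using elim(3) fin by (simp add: \<tau>2_def)
      have "(\<Prod>a\<in>Z. ?th a x powi n a) = (\<Prod>a\<in>Z. ?th a x ^ nat (n a) / ?th a x ^ nat (- n a))"
        using elim(3) by (intro prod.cong refl power_int_eq_divide) auto
      hence P: "(\<Prod>a\<in>Z. ?th a x powi n a) = \<tau>1 x / \<tau>2 x"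
        by (simp add: prod_dividef \<tau>1_def \<tau>2_def)
      have "exp (b * x) * (1 + exp (- b * x)) = exp (b * x) + exp (b * x + - b * x)"
        by (simp only: distrib_left exp_add mult_1_right)
      hence "exp (b * x) * (1 + exp (- b * x)) = 1 + exp (b * x)" by simp
      hence "exp (b * x) = (1 + exp (b * x)) / (1 + exp (- b * x))"
        using elim(2) by (metis nonzero_eq_divide_eq)
      hence "f x = C * ((1 + exp (b * x)) / (1 + exp (- b * x))) * (\<tau>1 x / \<tau>2 x)"
        using elim(1) P by metis
      also have "\<dots> = (\<tau>1 x * (C * (1 + exp (b * x)))) / (\<tau>2 x * (1 * (1 + exp (- b * x))))"
        by (simp add: mult_ac)
      finally have "f x = (\<tau>1 x * (C * (1 + exp (b * x)))) / (\<tau>2 x * (1 * (1 + exp (- b * x))))" .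
      moreover have "\<tau>2 x * (1 * (1 + exp (- b * x))) \<noteq> 0"
        using \<tau>2 elim(2) by (simp only: mult_1_left mult_eq_0_iff) blast
      ultimately show ?case by blast
    qed
  qed
  ultimately show ?thesis unfolding tau_quotient_def by blast
qed

text \<open>
  The variable is rescaled so that the lattice point \<open>l\<close> on the line through \<open>c\<close>
  becomes \<open>1\<close>; real multiples of \<open>c\<close> then correspond to real multiples of
  \<open>1\<close>, and the period \<open>1\<close> of the theta function to the real period \<open>t\<close>. The
  function \<open>\<psi>\<close> has multipliers along every lattice point, so the theta function may belong
  to the sublattice spanned by \<open>l\<close> and any \<open>q\<close> with $\mathrm{Im}(q/l) > 0$.
\<close>

lemma tau_quotient_second_kind:
  assumes om: "\<omega>\<^sub>1 \<noteq> 0" "Im (\<omega>\<^sub>2 / \<omega>\<^sub>1) > 0"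
    and mero: "\<psi> meromorphic_on UNIV" and nz: "\<not> (\<forall>\<^sub>\<approx>z. \<psi> z = 0)"
    and p: "\<forall>\<^sub>\<approx>z. \<psi> (z + 2 * \<omega>\<^sub>1) = \<rho> * \<psi> z" and q: "\<forall>\<^sub>\<approx>z. \<psi> (z + 2 * \<omega>\<^sub>2) = \<sigma> * \<psi> z"
    and c: "rational_direction \<omega>\<^sub>1 \<omega>\<^sub>2 c"
  shows "tau_quotient (\<lambda>x. \<psi> (c * x))"
proof -
  have mult: "\<exists>\<kappa>. \<kappa> \<noteq> 0 \<and> (\<forall>\<^sub>\<approx>z. \<psi> (z + l) = \<kappa> * \<psi> z)" if l: "l \<in> period_lattice \<omega>\<^sub>1 \<omega>\<^sub>2" for l
    using l multiplier_lattice[OF nz p q] unfolding period_lattice_def by blast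
  obtain t :: real where t: "t \<noteq> 0" "of_real t * c \<in> period_lattice \<omega>\<^sub>1 \<omega>\<^sub>2" and c0: "c \<noteq> 0"
    using c unfolding rational_direction_def by blast
  define l where "l = of_real t * c"
  have l0: "l \<noteq> 0" using t c0 by (simp add: l_def)
  have mem: "of_int m * (2 * \<omega>\<^sub>1) + of_int n * (2 * \<omega>\<^sub>2) \<in> period_lattice \<omega>\<^sub>1 \<omega>\<^sub>2" for m n
    unfolding period_lattice_def by blast
  \<comment> \<open>One of the generators is not a real multiple of l, since they are not real multiples of each other.\<close>
  have "Im (2 * \<omega>\<^sub>1 / l) \<noteq> 0 \<or> Im (2 * \<omega>\<^sub>2 / l) \<noteq> 0"
  proof (rule ccontr)
    assume "\<not> ?thesis"
    hence "2 * \<omega>\<^sub>1 / l \<in> \<real>" "2 * \<omega>\<^sub>2 / l \<in> \<real>" by (auto simp: complex_is_Real_iff)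
    hence "(2 * \<omega>\<^sub>2 / l) / (2 * \<omega>\<^sub>1 / l) \<in> \<real>" by (rule Reals_divide[rotated])
    hence "\<omega>\<^sub>2 / \<omega>\<^sub>1 \<in> \<real>" using l0 by simp
    thus False using om(2) by (simp add: complex_is_Real_iff)
  qed
  then consider "Im (2 * \<omega>\<^sub>1 / l) > 0" | "Im (- (2 * \<omega>\<^sub>1) / l) > 0"
    | "Im (2 * \<omega>\<^sub>2 / l) > 0" | "Im (- (2 * \<omega>\<^sub>2) / l) > 0"
    by fastforce
  hence "\<exists>q. q \<in> period_lattice \<omega>\<^sub>1 \<omega>\<^sub>2 \<and> Im (q / l) > 0"
    using mem[of 1 0] mem[of "-1" 0] mem[of 0 1] mem[of 0 "-1"]
    by cases auto
  then obtain q where q: "q \<in> period_lattice \<omega>\<^sub>1 \<omega>\<^sub>2" and tau: "Im (q / l) > 0" by blast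
  define g where "g = (\<lambda>y. \<psi> (l * y))"
  have pull: "\<exists>\<kappa>. \<kappa> \<noteq> 0 \<and> (\<forall>\<^sub>\<approx>y. g (y + r / l) = \<kappa> * g y)" if r: "r \<in> period_lattice \<omega>\<^sub>1 \<omega>\<^sub>2" for r
  proof -
    obtain \<kappa> where "\<kappa> \<noteq> 0" and \<kappa>: "\<forall>\<^sub>\<approx>z. \<psi> (z + r) = \<kappa> * \<psi> z" using mult[OF r] by blast
    have "\<forall>\<^sub>\<approx>y. g (y + r / l) = \<kappa> * g y"
      using cosparse_compose_affine[OF \<kappa> l0, of 0] l0 by (simp add: g_def distrib_left)
    with \<open>\<kappa> \<noteq> 0\<close> show ?thesis by blast
  qed
  obtain \<kappa> where \<kappa>: "\<kappa> \<noteq> 0" "\<forall>\<^sub>\<approx>y. g (y + 1) = \<kappa> * g y"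
    using pull[of l] t(2) l0 unfolding l_def by auto
  obtain \<kappa>' where \<kappa>': "\<kappa>' \<noteq> 0" "\<forall>\<^sub>\<approx>y. g (y + q / l) = \<kappa>' * g y"
    using pull[OF q] by blast
  have gmero: "g meromorphic_on UNIV"
    using meromorphic_on_compose_affine[OF mero, of l 0] by (simp add: g_def)
  have gnz: "\<not> (\<forall>\<^sub>\<approx>y. g y = 0)"
  proof
    assume *: "\<forall>\<^sub>\<approx>y. g y = 0"
    have "1 / l \<noteq> 0" using l0 by simp
    from cosparse_compose_affine[OF * this, of 0] have "\<forall>\<^sub>\<approx>z. \<psi> z = 0"
      using l0 by (simp add: g_def)
    with nz show False ..
  qed
  from second_kind_theta_factorization[OF tau gmero gnz \<kappa>(2) \<kappa>'(2) \<kappa>(1) \<kappa>'(1)]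
  obtain Z n C b where fin: "finite Z" and C: "C \<noteq> 0"
    and fact: "\<forall>\<^sub>\<approx>y. g y = C * exp (b * y) * (\<Prod>a\<in>Z. theta (q / l) (y - a) powi n a)"
    by blast
  have "1 / complex_of_real t \<noteq> 0" using t by simp
  from cosparse_compose_affine[OF fact this, of 0]
  have "\<forall>\<^sub>\<approx>x. \<psi> (c * x) = C * exp ((b / of_real t) * x) * (\<Prod>a\<in>Z. theta (q / l) (x / of_real t - a) powi n a)"
    using t(1) by (simp add: g_def l_def)
  with tau t(1) fin C show ?thesis by (rule tau_quotient_theta)
qed

theorem proposition7p2:
  fixes \<omega>\<^sub>1 \<omega>\<^sub>2 \<mu> :: complex and u :: "complex \<Rightarrow> complex"
  assumes "\<omega>\<^sub>1 \<noteq> 0" and "\<omega>\<^sub>2 \<noteq> 0" and "Im (\<omega>\<^sub>2 / \<omega>\<^sub>1) > 0"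
    and "elliptic_first_kind \<omega>\<^sub>1 \<omega>\<^sub>2 u"
    and "\<exists>\<psi>\<^sub>1 \<psi>\<^sub>2. hill_fundamental_system u \<mu> \<psi>\<^sub>1 \<psi>\<^sub>2"
  shows "\<exists>\<psi>. \<not> (\<forall>\<^sub>\<approx>z. \<psi> z = 0) \<and> hill_solution u \<mu> \<psi> \<and>
           elliptic_second_kind \<omega>\<^sub>1 \<omega>\<^sub>2 \<psi> \<and>
           (\<forall>c. rational_direction \<omega>\<^sub>1 \<omega>\<^sub>2 c \<longrightarrow> tau_quotient (\<lambda>x. \<psi> (c * x)))"
proof -
  obtain \<psi>\<^sub>1 \<psi>\<^sub>2 where fs: "hill_fundamental_system u \<mu> \<psi>\<^sub>1 \<psi>\<^sub>2" using assms(5) by blast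
  have lat: "of_int m * (2 * \<omega>\<^sub>1) + of_int n * (2 * \<omega>\<^sub>2) \<in> period_lattice \<omega>\<^sub>1 \<omega>\<^sub>2" for m n
    unfolding period_lattice_def by blast
  have per: "\<forall>\<^sub>\<approx>z. u (z + 2 * \<omega>\<^sub>1) = u z" "\<forall>\<^sub>\<approx>z. u (z + 2 * \<omega>\<^sub>2) = u z"
    using assms(4) lat[of 1 0] lat[of 0 1] unfolding elliptic_first_kind_def by auto
  obtain \<psi> \<rho> \<sigma> where nz: "\<not> (\<forall>\<^sub>\<approx>z. \<psi> z = 0)" and sol: "hill_solution u \<mu> \<psi>"
    and mult: "\<forall>\<^sub>\<approx>z. \<psi> (z + 2 * \<omega>\<^sub>1) = \<rho> * \<psi> z" "\<forall>\<^sub>\<approx>z. \<psi> (z + 2 * \<omega>\<^sub>2) = \<sigma> * \<psi> z"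
    using hill_common_floquet_solution[OF fs per] by blast
  have mero: "\<psi> meromorphic_on UNIV" using sol by (simp add: hill_solution_def)
  have "elliptic_second_kind \<omega>\<^sub>1 \<omega>\<^sub>2 \<psi>"
    unfolding elliptic_second_kind_def using mero mult by blast
  moreover have "tau_quotient (\<lambda>x. \<psi> (c * x))" if "rational_direction \<omega>\<^sub>1 \<omega>\<^sub>2 c" for c
    using tau_quotient_second_kind[OF assms(1,3) mero nz mult that] .
  ultimately show ?thesis using nz sol by blast
qed

end
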